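(* Let $\rho$ be the autocovariance function of the weakly stationary solution $X$ of the ARCH($\infty$) equations with data $a$, $b$, $\xi$. Suppose that $\lambda_1B<1$ and $\Omega<1$. Then the following are equivalent: (a) there exist $\alpha_1\in(0,1)$ and $C_1\in(0,\infty)$ such that $b(k)\le C_1\alpha_1^k$ for all integers $k\ge1$; (b) there exist $\alpha_2\in(0,1)$ and $C_2\in(0,\infty)$ such that $\rho(k)\le C_2\alpha_2^k$ for all integers $k\ge0$.
   Context: ARCH($\infty$) setting. Let $\xi=\{\xi(k)\}_{k\in\mathbb{Z}}$ be i.i.d. non-negative random variables, $a\ge 0$ a constant, and $b=\{b(j)\}_{j\ge1}$ a real sequence with $b(j)\ge 0$. A random sequence $X=\{X(k)\}_{k\in\mathbb{Z}}$ satisfies the ARCH($\infty$) equations if $X(k)=\varsigma(k)\xi(k)$, $\varsigma(k)=a+\sum_{j=1}^\infty b(j)X(k-j)$ for all $k\in\mathbb{Z}$. Put $\lambda_1=\mathbb{E}[\xi(0)]$, $\lambda_2=\mathbb{E}[\xi(0)^2]$, $\sigma^2=\mathrm{Var}[\xi(0)]=\lambda_2-\lambda_1^2$, $B=\sum_{j=1}^\infty b(j)$, $\nu(k)=X(k)-\lambda_1\varsigma(k)$. Standing assumptions: $\lambda_1\in(0,\infty)$, $a>0$, $\sigma\in(0,\infty)$, and $b$ is not identically zero. The sequence $z$ is defined by $z(0)=1$, $z(n)=\lambda_1\sum_{j=0}^{n-1}b(n-j)z(j)$ for $n\ge 1$ (when $\lambda_1B<1$, these are the power series coefficients of $1/(1-\lambda_1\sum_{j\ge1}b(j)\lambda^j)$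 on $|\lambda|\le 1$), and $\Omega=\frac{\sigma}{\lambda_1}\big(\sum_{j=1}^\infty z(j)^2\big)^{1/2}$. A process is (weakly) stationary if it has constant finite mean and $\mathrm{Cov}[X(n),X(n+k)]$ depends only on $k$; $\rho(k)=\mathrm{Cov}[X(n),X(n+k)]$, $k\in\mathbb{Z}$, is its autocovariance function. Known fact (recalled by the paper): if $\lambda_1B<1$ and $\Omega<1$, there is a unique weakly stationary solution $X$ of the ARCH($\infty$) equations; it satisfies $\rho(k)=\mathbb{E}[\nu(0)^2]\sum_{j=0}^\infty z(j)z(j+|k|)$ for $k\in\mathbb{Z}$, with $\mathbb{E}[\nu(0)^2]=\big(\frac{a\sigma}{1-\lambda_1B}\big)^2\frac{1}{1-\Omega^2}$. *)

theory Defs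
  imports "HOL-Probability.Probability"
begin

definition covariance :: "'w measure \<Rightarrow> ('w \<Rightarrow> real) \<Rightarrow> ('w \<Rightarrow> real) \<Rightarrow> real" where
  "covariance M U V =
     (\<integral>\<omega>. (U \<omega> - (\<integral>\<eta>. U \<eta> \<partial>M)) * (V \<omega> - (\<integral>\<eta>. V \<eta> \<partial>M)) \<partial>M)"

text \<open>Square integrability makes means and covariances genuine: the Bochner integral of a
  non-integrable function is 0.\<close>

definition weakly_stationary :: "'w measure \<Rightarrow> (int \<Rightarrow> 'w \<Rightarrow> real) \<Rightarrow> bool" where
  "weakly_stationary M X \<longleftrightarrow>
     (\<forall>n. X n \<in> borel_measurable M \<and> integrable M (X n) \<and> integrable M (\<lambda>\<omega>. (X n \<omega>)\<^sup>2)) \<and>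
     (\<forall>m n. (\<integral>\<omega>. X m \<omega> \<partial>M) = (\<integral>\<omega>. X n \<omega> \<partial>M)) \<and>
     (\<forall>m n k. covariance M (X m) (X (m + k)) = covariance M (X n) (X (n + k)))"

text \<open>Based at time 0; for a weakly stationary process the base point is immaterial.\<close>

definition autocovariance :: "'w measure \<Rightarrow> (int \<Rightarrow> 'w \<Rightarrow> real) \<Rightarrow> int \<Rightarrow> real" where
  "autocovariance M X k = covariance M (X 0) (X (0 + k))"

definition iid_sequence :: "'w measure \<Rightarrow> (int \<Rightarrow> 'w \<Rightarrow> real) \<Rightarrow> bool" where
  "iid_sequence M \<xi> \<longleftrightarrow>
     prob_space.indep_vars M (\<lambda>_. borel) \<xi> UNIV \<and>
     (\<forall>k. distr M borel (\<xi> k) = distr M borel (\<xi> 0))"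

text \<open>Throughout, the coefficients are the values of \<open>b\<close> at indices at least 1, so series run
  over \<open>b (Suc j)\<close> and the value \<open>b 0\<close> is never used.\<close>

definition arch_vol ::
    "real \<Rightarrow> (nat \<Rightarrow> real) \<Rightarrow> (int \<Rightarrow> 'w \<Rightarrow> real) \<Rightarrow> int \<Rightarrow> 'w \<Rightarrow> real" where
  "arch_vol a b X k \<omega> = a + (\<Sum>j. b (Suc j) * X (k - int (Suc j)) \<omega>)"

definition arch_solution ::
    "'w measure \<Rightarrow> (int \<Rightarrow> 'w \<Rightarrow> real) \<Rightarrow> real \<Rightarrow> (nat \<Rightarrow> real) \<Rightarrow> (int \<Rightarrow> 'w \<Rightarrow> real) \<Rightarrow> bool" where
  "arch_solution M \<xi> a b X \<longleftrightarrow>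
     (\<forall>k. X k \<in> borel_measurable M) \<and>
     (\<forall>k. AE \<omega> in M. summable (\<lambda>j. b (Suc j) * X (k - int (Suc j)) \<omega>) \<and>
                     X k \<omega> = arch_vol a b X k \<omega> * \<xi> k \<omega>)"

fun arch_z :: "real \<Rightarrow> (nat \<Rightarrow> real) \<Rightarrow> nat \<Rightarrow> real" where
  "arch_z l b 0 = 1"
| "arch_z l b (Suc n) = l * (\<Sum>j\<le>n. b (Suc n - j) * arch_z l b j)"

definition arch_mean :: "'w measure \<Rightarrow> (int \<Rightarrow> 'w \<Rightarrow> real) \<Rightarrow> real" where
  "arch_mean M \<xi> = (\<integral>\<omega>. \<xi> 0 \<omega> \<partial>M)"

definition arch_sd :: "'w measure \<Rightarrow> (int \<Rightarrow> 'w \<Rightarrow> real) \<Rightarrow> real" where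
  "arch_sd M \<xi> = sqrt (prob_space.variance M (\<xi> 0))"

definition arch_Omega :: "'w measure \<Rightarrow> (int \<Rightarrow> 'w \<Rightarrow> real) \<Rightarrow> (nat \<Rightarrow> real) \<Rightarrow> real" where
  "arch_Omega M \<xi> b =
     arch_sd M \<xi> / arch_mean M \<xi> * sqrt (\<Sum>j. (arch_z (arch_mean M \<xi>) b (Suc j))\<^sup>2)"

end

theory Submission
  imports Defs
begin

text \<open>
  The equivalence is read off the Yule--Walker equation
  \<open>\<rho> k = \<lambda>\<^sub>1 * (\<Sum>j\<ge>1. b j * \<rho> (k - j))\<close> for \<open>k \<ge> 1\<close>, together with \<open>\<lambda>\<^sub>1 * (\<Sum>j\<ge>1. b j) < 1\<close> and
  \<open>\<bar>\<rho> k\<bar> \<le> \<rho> 0\<close>. Inserting a lower bound for \<open>\<rho>\<close> into the right-hand side multiplies it by a factor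
  below 1, so \<open>\<rho>\<close> is non-negative (\<open>yule_walker_nonneg\<close>). Keeping only the term \<open>j = k\<close> then gives
  \<open>\<lambda>\<^sub>1 * \<rho> 0 * b k \<le> \<rho> k\<close>, and \<open>\<rho> 0 > 0\<close>, so geometric decay of \<open>\<rho>\<close> passes to \<open>b\<close>. Conversely, if \<open>b\<close>
  decays geometrically, then \<open>\<lambda>\<^sub>1 * (\<Sum>j\<ge>1. b j * R ^ j) \<le> 1\<close> for some \<open>R > 1\<close> by continuity of the power
  series, and induction on \<open>k\<close> gives \<open>\<rho> k * R ^ k \<le> \<rho> 0\<close> (\<open>yule_walker_decay\<close>).

  The Yule--Walker equation rests on the independence of \<open>\<xi> k\<close> from the variables \<open>X j\<close> with \<open>j < k\<close>. A
  solution of the ARCH equations is not causal by definition, so causality has to be proved. Iterating the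
  equations backwards from time \<open>k\<close> gives
  \<open>X k = a * (\<Sum>m\<le>n. \<xi> (k - m) * c m)\<close> plus a remainder that is linear in the values \<open>X i\<close> with
  \<open>i < k - n\<close>; here \<open>c m\<close> is a polynomial in \<open>\<xi> k, \<dots>, \<xi> (k - m + 1)\<close>, the response at lag \<open>m\<close> to a unit
  impulse. The values \<open>X i\<close> may depend on the weights of the remainder, so the remainder is
  estimated by the Cauchy--Schwarz inequality. This bounds its \<open>L\<^sup>1\<close>-norm by a tail of the convolution of \<open>b\<close>
  with the norms \<open>\<parallel>c m\<parallel>\<^sub>2\<close>, and causality follows if these norms are summable (\<open>causal_representation\<close>).

  Expanding \<open>\<xi> = \<lambda>\<^sub>1 + (\<xi> - \<lambda>\<^sub>1)\<close> and using orthogonality of martingale differences, one finds that the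
  numbers \<open>u n = \<parallel>c n\<parallel>\<^sub>2\<^sup>2\<close> solve the renewal equation \<open>u = z\<^sup>2 + g * u\<close> with convolution kernel
  \<open>g j = (\<sigma> / \<lambda>\<^sub>1)\<^sup>2 * (z j)\<^sup>2\<close>, \<open>j \<ge> 1\<close>, of total mass \<open>\<Omega>\<^sup>2 < 1\<close> (\<open>second_moment_renewal\<close>). Summability of
  \<open>u\<close> is immediate; what is needed is the summability of \<open>\<surd>u\<close>. It holds because \<open>z\<close> itself is summable, by an
  instance of Wiener's lemma in the convolution algebra of sequences with summable square roots
  (\<open>summable_sqrt_renewal\<close>).
\<close>

section \<open>Convolutions and renewal equations\<close>

text \<open>The convolutions below never use the kernel at index 0. Setting that coefficient to 0 turns them into
  products of formal power series, so that renewal equations can be solved by ring algebra.\<close>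

lemma fps_mult_strict_nth:
  fixes g u :: "nat \<Rightarrow> real"
  shows "fps_nth (Abs_fps u * Abs_fps (\<lambda>n. if n = 0 then 0 else g n)) n = (\<Sum>i<n. g (n - i) * u i)"
proof -
  have "fps_nth (Abs_fps u * Abs_fps (\<lambda>n. if n = 0 then 0 else g n)) n
      = (\<Sum>i\<in>insert n {..<n}. u i * (if n - i = 0 then 0 else g (n - i)))"
    unfolding fps_mult_nth by (rule sum.cong) auto
  also have "\<dots> = (\<Sum>i<n. g (n - i) * u i)"
    by (subst sum.insert) (auto intro!: sum.cong)
  finally show ?thesis .
qed

lemma sum_convolution_le:
  fixes h v :: "nat \<Rightarrow> real"
  assumes "\<And>j. 0 \<le> h (Suc j)" "\<And>i. 0 \<le> v i" "summable (\<lambda>j. h (Suc j))"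
  shows "(\<Sum>n<N. \<Sum>i<n. h (n - i) * v i) \<le> (\<Sum>j. h (Suc j)) * (\<Sum>i<N. v i)"
proof -
  have "(\<Sum>n<N. \<Sum>i<n. h (n - i) * v i) = (\<Sum>i<N. \<Sum>n\<in>{Suc i..<N}. h (n - i) * v i)"
    by (subst (1 2) sum.Sigma, simp, simp, simp, simp, rule sum.reindex_bij_witness[of _ prod.swap prod.swap]) auto
  also have "\<dots> \<le> (\<Sum>i<N. (\<Sum>j. h (Suc j)) * v i)"
  proof (rule sum_mono)
    fix i assume "i \<in> {..<N}"
    have "(\<Sum>n\<in>{Suc i..<N}. h (n - i) * v i) = (\<Sum>j<N - Suc i. h (Suc j)) * v i"
      unfolding sum_distrib_right
      by (rule sum.reindex_bij_witness[of _ "\<lambda>j. Suc i + j" "\<lambda>n. n - Suc i"]) (auto simp: Suc_diff_Suc)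
    also have "\<dots> \<le> (\<Sum>j. h (Suc j)) * v i"
      using assms by (intro mult_right_mono sum_le_suminf) auto
    finally show "(\<Sum>n\<in>{Suc i..<N}. h (n - i) * v i) \<le> (\<Sum>j. h (Suc j)) * v i" .
  qed
  also have "\<dots> = (\<Sum>j. h (Suc j)) * (\<Sum>i<N. v i)"
    by (simp add: sum_distrib_left)
  finally show ?thesis .
qed

lemma summable_convolution:
  fixes h v :: "nat \<Rightarrow> real"
  assumes h: "\<And>j. 0 \<le> h (Suc j)" "summable (\<lambda>j. h (Suc j))" and v: "\<And>i. 0 \<le> v i" "summable v"
  shows "summable (\<lambda>n. \<Sum>i<n. h (n - i) * v i)"
proof (rule summableI_nonneg_bounded)
  show "0 \<le> (\<Sum>i<n. h (n - i) * v i)" for n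
  proof (intro sum_nonneg mult_nonneg_nonneg v)
    fix i assume "i \<in> {..<n}"
    then show "0 \<le> h (n - i)" using h(1)[of "n - Suc i"] by (simp add: Suc_diff_Suc)
  qed
  fix N
  have "(\<Sum>n<N. \<Sum>i<n. h (n - i) * v i) \<le> (\<Sum>j. h (Suc j)) * (\<Sum>i<N. v i)"
    using h v by (intro sum_convolution_le)
  also have "\<dots> \<le> (\<Sum>j. h (Suc j)) * (\<Sum>i. v i)"
    using h v by (intro mult_left_mono sum_le_suminf suminf_nonneg) auto
  finally show "(\<Sum>n<N. \<Sum>i<n. h (n - i) * v i) \<le> (\<Sum>j. h (Suc j)) * (\<Sum>i. v i)" .
qed

lemma sqrt_sum_le:
  fixes x :: "'i \<Rightarrow> real"
  assumes "finite A" "\<And>i. i \<in> A \<Longrightarrow> 0 \<le> x i"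
  shows "sqrt (\<Sum>i\<in>A. x i) \<le> (\<Sum>i\<in>A. sqrt (x i))"
  using assms
proof (induction A rule: finite_induct)
  case (insert i A)
  have "sqrt (x i + sum x A) \<le> sqrt (x i) + sqrt (sum x A)"
    using insert.prems by (intro sqrt_add_le_add_sqrt) (auto intro: sum_nonneg)
  with insert show ?case by fastforce
qed simp

text \<open>Wiener's lemma for the resolvent of a kernel \<open>g\<close> of mass below 1, where the size of a sequence
  is measured by the sum of its square roots. Subadditivity of the square root alone would need
  \<open>(\<Sum>j. sqrt (g (Suc j))) < 1\<close>. This is too much to ask, since only \<open>\<Sum>j. g (Suc j)\<close> is controlled. The cure is to
  replace \<open>u\<close> by its discounted sums \<open>V n = (\<Sum>i\<le>n. \<theta> ^ (n - i) * u i)\<close>, which dominate \<open>u\<close> and solve the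
  same equation with a discounted source. As \<open>V (n - j) \<le> V n / \<theta> ^ j\<close>, the first \<open>L\<close> terms of the kernel
  contribute at most \<open>\<theta> ^ (- L) * (\<Sum>j. g (Suc j))\<close> times \<open>V n\<close>, so that it is the mass of \<open>g\<close> that counts for
  them; subadditivity is applied only to the tail of the kernel beyond \<open>L\<close>, which is small. For \<open>\<theta>\<close> close to
  1 the two contributions together stay below 1.\<close>

lemma summable_sqrt_renewal:
  fixes f g u :: "nat \<Rightarrow> real"
  assumes f0: "\<And>n. 0 \<le> f n" and g0: "\<And>n. 0 \<le> g n" and u0: "\<And>n. 0 \<le> u n"
    and f: "summable (\<lambda>n. sqrt (f n))"
    and sg: "summable (\<lambda>n. sqrt (g (Suc n)))"
    and g: "summable (\<lambda>n. g (Suc n))" and g1: "(\<Sum>n. g (Suc n)) < 1"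
    and u: "\<And>n. u n = f n + (\<Sum>i<n. g (n - i) * u i)"
  shows "summable (\<lambda>n. sqrt (u n))"
proof -
  define G where "G = sqrt (\<Sum>n. g (Suc n))"
  have G: "0 \<le> G" "G < 1"
    using g1 suminf_nonneg[OF g] g0 by (auto simp: G_def)
  define \<epsilon> where "\<epsilon> = (1 - G) / 3"
  have \<epsilon>: "0 < \<epsilon>" using G by (simp add: \<epsilon>_def)
  obtain L where L: "norm (\<Sum>j. sqrt (g (Suc (j + L)))) < \<epsilon>"
    using suminf_exist_split[OF \<epsilon> sg] by auto
  \<comment> \<open>the discount factor is \<open>t\<^sup>2\<close>, chosen close to 1 depending on \<open>L\<close>\<close>
  obtain t :: real where t: "0 < t" "t < 1" "G < t ^ L * (G + \<epsilon>)"
  proof -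
    have "((\<lambda>t. t ^ L * (G + \<epsilon>)) \<longlongrightarrow> 1 ^ L * (G + \<epsilon>)) (at_left (1::real))"
      by (intro tendsto_intros)
    then have "\<forall>\<^sub>F t in at_left (1::real). G < t ^ L * (G + \<epsilon>)"
      by (rule order_tendstoD) (use \<epsilon> in simp)
    moreover have "\<forall>\<^sub>F t in at_left (1::real). t \<in> {0<..<1}"
      by (rule eventually_at_leftI[of 0]) auto
    ultimately have "\<forall>\<^sub>F t in at_left (1::real). G < t ^ L * (G + \<epsilon>) \<and> t \<in> {0<..<1}"
      by (rule eventually_conj)
    from eventually_happens[OF this] show ?thesis using that by auto
  qed
  define disc where "disc x n = (\<Sum>i\<le>n. (t\<^sup>2) ^ (n - i) * x i)" for x n
  define V where "V = disc u"
  have disc_fps: "Abs_fps (disc x) = Abs_fps (\<lambda>n. (t\<^sup>2) ^ n) * Abs_fps x" for x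
    by (rule fps_ext, subst mult.commute)
       (simp add: disc_def fps_mult_nth atMost_atLeast0 mult.commute)
  have V: "V n = disc f n + (\<Sum>i<n. g (n - i) * V i)" for n
  proof -
    let ?G = "Abs_fps (\<lambda>n. if n = 0 then 0 else g n)"
    have U: "Abs_fps u = Abs_fps f + Abs_fps u * ?G"
      by (rule fps_ext, simp add: fps_mult_strict_nth) (rule u)
    have "Abs_fps V = Abs_fps (\<lambda>n. (t\<^sup>2) ^ n) * (Abs_fps f + Abs_fps u * ?G)"
      unfolding V_def disc_fps by (rule arg_cong[OF U])
    also have "\<dots> = Abs_fps (disc f) + Abs_fps V * ?G"
      unfolding V_def disc_fps by (simp only: distrib_left mult.assoc)
    finally have "Abs_fps V = Abs_fps (disc f) + Abs_fps V * ?G" .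
    then have "fps_nth (Abs_fps V) n = fps_nth (Abs_fps (disc f) + Abs_fps V * ?G) n"
      by simp
    then show ?thesis by (simp add: fps_mult_strict_nth)
  qed
  have V0: "0 \<le> V n" for n
    unfolding V_def disc_def using u0 t by (intro sum_nonneg) auto
  have uV: "u n \<le> V n" for n
  proof -
    have "u n = (\<Sum>i\<in>{n}. (t\<^sup>2) ^ (n - i) * u i)" by simp
    also have "\<dots> \<le> V n"
      unfolding V_def disc_def using u0 t by (intro sum_mono2) auto
    finally show ?thesis .
  qed
  have V_shift: "(t\<^sup>2) ^ (n - i) * V i \<le> V n" if "i \<le> n" for i n
  proof -
    have "(t\<^sup>2) ^ (n - i) * V i = (\<Sum>m\<le>i. (t\<^sup>2) ^ (n - m) * u m)"
      unfolding V_def disc_def sum_distrib_left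
    proof (rule sum.cong)
      fix m assume "m \<in> {..i}"
      then have "n - m = (n - i) + (i - m)" using that by simp
      then show "(t\<^sup>2) ^ (n - i) * ((t\<^sup>2) ^ (i - m) * u m) = (t\<^sup>2) ^ (n - m) * u m"
        by (simp only: power_add mult.assoc)
    qed simp
    also have "\<dots> \<le> V n"
      unfolding V_def disc_def using u0 t that by (intro sum_mono2) auto
    finally show ?thesis .
  qed
  \<comment> \<open>the tail of the kernel, for which subadditivity of the square root suffices\<close>
  define h where "h j = (if j \<le> L then 0 else sqrt (g j))" for j
  have h0: "0 \<le> h j" for j by (simp add: h_def g0)
  have hs: "summable (\<lambda>j. h (Suc j))"
    by (rule summable_comparison_test'[OF sg, of 0]) (auto simp: h_def g0)
  have h1: "(\<Sum>j. h (Suc j)) < \<epsilon>"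
  proof -
    have "(\<Sum>j. h (Suc j)) = (\<Sum>j. h (Suc (j + L))) + (\<Sum>j<L. h (Suc j))"
      by (rule suminf_split_initial_segment[OF hs])
    also have "\<dots> = (\<Sum>j. sqrt (g (Suc (j + L))))" by (simp add: h_def)
    finally show ?thesis using L by simp
  qed
  have head: "sqrt (\<Sum>i\<in>{i. i < n \<and> n - i \<le> L}. g (n - i) * V i) \<le> (G + \<epsilon>) * sqrt (V n)" for n
  proof -
    have "(t\<^sup>2) ^ L * (\<Sum>i\<in>{i. i < n \<and> n - i \<le> L}. g (n - i) * V i)
        \<le> (\<Sum>i\<in>{i. i < n \<and> n - i \<le> L}. g (n - i) * V n)"
      unfolding sum_distrib_left
    proof (rule sum_mono)
      fix i assume i: "i \<in> {i. i < n \<and> n - i \<le> L}"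
      have "(t\<^sup>2) ^ L * V i \<le> (t\<^sup>2) ^ (n - i) * V i"
        using i t V0 by (intro mult_right_mono power_decreasing) (auto simp: power_le_one)
      also have "\<dots> \<le> V n" using V_shift i by auto
      finally have "g (n - i) * ((t\<^sup>2) ^ L * V i) \<le> g (n - i) * V n"
        using g0 by (intro mult_left_mono)
      then show "(t\<^sup>2) ^ L * (g (n - i) * V i) \<le> g (n - i) * V n"
        by (simp only: mult.left_commute)
    qed
    also have "\<dots> \<le> (\<Sum>i<n. g (n - i)) * V n"
      unfolding sum_distrib_right using g0 V0 by (intro sum_mono2) auto
    also have "(\<Sum>i<n. g (n - i)) = (\<Sum>j<n. g (Suc j))"
      by (rule sum.reindex_bij_witness[of _ "\<lambda>j. n - Suc j" "\<lambda>i. n - Suc i"]) (auto simp: Suc_diff_Suc)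
    also have "\<dots> * V n \<le> (\<Sum>j. g (Suc j)) * V n"
      using g g0 V0 by (intro mult_right_mono sum_le_suminf) auto
    finally have "sqrt ((t\<^sup>2) ^ L * (\<Sum>i\<in>{i. i < n \<and> n - i \<le> L}. g (n - i) * V i))
      \<le> sqrt ((\<Sum>j. g (Suc j)) * V n)" by (rule real_sqrt_le_mono)
    then have "t ^ L * sqrt (\<Sum>i\<in>{i. i < n \<and> n - i \<le> L}. g (n - i) * V i) \<le> G * sqrt (V n)"
      using t by (simp add: real_sqrt_mult real_sqrt_power G_def)
    also have "\<dots> \<le> (t ^ L * (G + \<epsilon>)) * sqrt (V n)"
      using t V0 by (intro mult_right_mono) auto
    finally show ?thesis using t by (simp add: mult.assoc)
  qed
  have step: "sqrt (V n) \<le> sqrt (disc f n) + (G + \<epsilon>) * sqrt (V n) + (\<Sum>i<n. h (n - i) * sqrt (V i))" for n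
  proof -
    let ?A = "{i. i < n \<and> n - i \<le> L}" and ?B = "{i. i < n \<and> \<not> n - i \<le> L}"
    have AB: "{..<n} = ?A \<union> ?B" by auto
    have fin: "finite ?A" "finite ?B" by auto
    have nn: "0 \<le> disc f n" "0 \<le> (\<Sum>i\<in>?A. g (n - i) * V i)" "0 \<le> (\<Sum>i\<in>?B. g (n - i) * V i)"
      unfolding disc_def using f0 g0 V0 t by (auto intro!: sum_nonneg)
    define a1 a2 where "a1 = (\<Sum>i\<in>?A. g (n - i) * V i)" and "a2 = (\<Sum>i\<in>?B. g (n - i) * V i)"
    note nn = nn[folded a1_def a2_def]
    have "V n = disc f n + (a1 + a2)"
      unfolding V[of n] AB a1_def a2_def by (subst sum.union_disjoint) auto
    then have "sqrt (V n) \<le> sqrt (disc f n) + sqrt (a1 + a2)"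
      using nn by (simp add: sqrt_add_le_add_sqrt)
    moreover have "sqrt (a1 + a2) \<le> sqrt a1 + sqrt a2"
      using nn by (intro sqrt_add_le_add_sqrt)
    moreover have "sqrt a2 \<le> (\<Sum>i\<in>?B. sqrt (g (n - i) * V i))"
      unfolding a2_def using g0 V0 by (intro sqrt_sum_le) auto
    moreover have "(\<Sum>i\<in>?B. sqrt (g (n - i) * V i)) = (\<Sum>i<n. h (n - i) * sqrt (V i))"
      by (rule sum.mono_neutral_cong_left) (auto simp: h_def real_sqrt_mult)
    ultimately show ?thesis using head[of n] unfolding a1_def by linarith
  qed
  define \<Phi> where "\<Phi> = (1 + (\<Sum>j. t ^ Suc j)) * (\<Sum>n. sqrt (f n))"
  have \<Phi>: "(\<Sum>n<N. sqrt (disc f n)) \<le> \<Phi>" for N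
  proof -
    have st: "summable (\<lambda>j. t ^ Suc j)"
      using t by (subst summable_Suc_iff) (auto intro: summable_geometric)
    have "(\<Sum>n<N. sqrt (disc f n)) \<le> (\<Sum>n<N. (\<Sum>i<n. t ^ (n - i) * sqrt (f i)) + sqrt (f n))"
    proof (rule sum_mono)
      fix n
      have "sqrt (disc f n) \<le> (\<Sum>i\<le>n. sqrt ((t\<^sup>2) ^ (n - i) * f i))"
        unfolding disc_def using f0 t by (intro sqrt_sum_le) auto
      also have "\<dots> = (\<Sum>i\<le>n. t ^ (n - i) * sqrt (f i))"
        using t by (simp add: real_sqrt_mult real_sqrt_power)
      also have "\<dots> = (\<Sum>i<n. t ^ (n - i) * sqrt (f i)) + sqrt (f n)"
        by (simp add: lessThan_Suc_atMost[symmetric])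
      finally show "sqrt (disc f n) \<le> (\<Sum>i<n. t ^ (n - i) * sqrt (f i)) + sqrt (f n)" .
    qed
    also have "\<dots> = (\<Sum>n<N. \<Sum>i<n. t ^ (n - i) * sqrt (f i)) + (\<Sum>n<N. sqrt (f n))"
      by (rule sum.distrib)
    also have "\<dots> \<le> (\<Sum>j. t ^ Suc j) * (\<Sum>n<N. sqrt (f n)) + (\<Sum>n<N. sqrt (f n))"
      using t f0 st by (intro add_right_mono sum_convolution_le) auto
    also have "\<dots> = (1 + (\<Sum>j. t ^ Suc j)) * (\<Sum>n<N. sqrt (f n))" by (simp add: algebra_simps)
    also have "\<dots> \<le> \<Phi>"
      unfolding \<Phi>_def using f f0 t suminf_nonneg[OF st] by (intro mult_left_mono sum_le_suminf) auto
    finally show ?thesis .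
  qed
  have bound: "(\<Sum>n<N. sqrt (u n)) \<le> \<Phi> / \<epsilon>" for N
  proof -
    define S where "S = (\<Sum>n<N. sqrt (V n))"
    have S0: "0 \<le> S" unfolding S_def using V0 by (intro sum_nonneg) auto
    have "S \<le> (\<Sum>n<N. sqrt (disc f n)) + (G + \<epsilon>) * S + (\<Sum>n<N. \<Sum>i<n. h (n - i) * sqrt (V i))"
      unfolding S_def sum_distrib_left sum.distrib[symmetric] by (rule sum_mono) (rule step)
    also have "(\<Sum>n<N. \<Sum>i<n. h (n - i) * sqrt (V i)) \<le> (\<Sum>j. h (Suc j)) * S"
      unfolding S_def using h0 V0 hs by (intro sum_convolution_le) auto
    also have "\<dots> \<le> \<epsilon> * S" using h1 S0 by (intro mult_right_mono) auto
    finally have "S \<le> \<Phi> + (G + \<epsilon>) * S + \<epsilon> * S" using \<Phi>[of N] by linarith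
    \<comment> \<open>\<open>\<epsilon>\<close> is a third of \<open>1 - G\<close>: one part for the discounting, one for the tail, one is gained\<close>
    moreover have "(G + \<epsilon>) * S + \<epsilon> * S + \<epsilon> * S = S"
      unfolding \<epsilon>_def by (simp add: field_simps)
    ultimately have "\<epsilon> * S \<le> \<Phi>" by linarith
    moreover have "(\<Sum>n<N. sqrt (u n)) \<le> S"
      unfolding S_def using uV by (intro sum_mono) simp
    moreover have "S \<le> \<Phi> / \<epsilon>"
      using \<open>\<epsilon> * S \<le> \<Phi>\<close> \<epsilon> by (simp add: pos_le_divide_eq mult.commute)
    ultimately show ?thesis by linarith
  qed
  show ?thesis
    by (rule summableI_nonneg_bounded[OF _ bound]) (simp add: u0)
qed

section \<open>Impulse responses\<close>

text \<open>The volatility at time \<open>n\<close> of the ARCH recursion without constant term, driven by the innovations \<open>x\<close> and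
  started from volatility 1 at time 0. By symmetry of the sum over paths it is also the weight that
  backward iteration of the recursion attaches to the value at lag \<open>n\<close>, the innovations then being read
  backwards in time.\<close>

fun impulse :: "(nat \<Rightarrow> real) \<Rightarrow> (nat \<Rightarrow> real) \<Rightarrow> nat \<Rightarrow> real" where
  "impulse b x 0 = 1"
| "impulse b x (Suc n) = (\<Sum>j\<le>n. b (Suc n - j) * x j * impulse b x j)"

lemma impulse_pos: "0 < n \<Longrightarrow> impulse b x n = (\<Sum>j<n. b (n - j) * x j * impulse b x j)"
  by (cases n) (auto simp: lessThan_Suc_atMost)

lemma impulse_cong: "(\<And>j. j < n \<Longrightarrow> x j = y j) \<Longrightarrow> impulse b x n = impulse b y n"
proof (induction n rule: less_induct)
  case (less n)
  show ?case
    by (cases "n = 0") (use less in \<open>auto simp: impulse_pos intro!: sum.cong\<close>)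
qed

text \<open>Averaging out the innovations turns the impulse response into the deterministic sequence \<open>z\<close>.\<close>

lemma impulse_const: "impulse b (\<lambda>_. l) n = arch_z l b n"
proof (induction n rule: less_induct)
  case (less n)
  show ?case
    by (cases n) (use less in \<open>auto simp: sum_distrib_left intro!: sum.cong\<close>)
qed

text \<open>A variation-of-constants formula: \<open>z\<close> is the resolvent of the kernel \<open>l * b\<close>, and the deviations \<open>x i - l\<close>
  act as a source term. In generating functions, \<open>C = 1 + (l * C + M) * B\<close> and \<open>(1 - l * B) * Z = 1\<close> give
  \<open>C = (1 + M * B) * Z\<close>.\<close>

lemma impulse_perturbation:
  "l * impulse b x n = l * arch_z l b n + (\<Sum>i<n. arch_z l b (n - i) * ((x i - l) * impulse b x i))"
proof -
  let ?B = "Abs_fps (\<lambda>n. if n = 0 then 0 else b n)"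
  define M where "M = Abs_fps (\<lambda>i. (x i - l) * impulse b x i)"
  define C where "C y = Abs_fps (impulse b y)" for y
  let ?Z = "Abs_fps (\<lambda>n. if n = 0 then 0 else arch_z l b n)"
  have C: "C y = 1 + Abs_fps (\<lambda>i. y i * impulse b y i) * ?B" for y
    by (rule fps_ext) (auto simp: fps_mult_strict_nth C_def impulse_pos mult.assoc)
  have Z: "C (\<lambda>_. l) = 1 + ?Z"
    by (rule fps_ext) (auto simp: C_def impulse_const)
  have "Abs_fps (\<lambda>i. l * impulse b (\<lambda>_. l) i) = fps_const l * (1 + ?Z)"
    by (rule fps_ext) (auto simp: impulse_const)
  with C[of "\<lambda>_. l"] Z have Z': "?Z = fps_const l * (1 + ?Z) * ?B" by simp
  have "Abs_fps (\<lambda>i. x i * impulse b x i) = fps_const l * C x + M"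
    by (rule fps_ext) (auto simp: C_def M_def algebra_simps)
  with C[of x] have Cx: "C x = 1 + (fps_const l * C x + M) * ?B" by simp
  have "(1 - fps_const l * ?B) * (1 + ?Z) = 1 + (?Z - fps_const l * (1 + ?Z) * ?B)"
    by (simp add: algebra_simps)
  also have "\<dots> = 1" by (subst Z'[symmetric]) simp
  finally have inv: "(1 - fps_const l * ?B) * (1 + ?Z) = 1" .
  have "C x * (1 - fps_const l * ?B) = C x - fps_const l * C x * ?B"
    by (simp add: algebra_simps)
  also have "\<dots> = (1 + (fps_const l * C x + M) * ?B) - fps_const l * C x * ?B"
    by (subst (1) Cx) (rule refl)
  also have "\<dots> = 1 + M * ?B" by (simp add: algebra_simps)
  finally have "C x * (1 - fps_const l * ?B) * (1 + ?Z) = (1 + M * ?B) * (1 + ?Z)" by simp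
  then have "C x = (1 + M * ?B) * (1 + ?Z)" by (simp only: mult.assoc inv mult_1_right)
  then have "fps_const l * C x = fps_const l * (1 + ?Z) + M * (fps_const l * (1 + ?Z) * ?B)"
    by (simp add: algebra_simps)
  also have "fps_const l * (1 + ?Z) * ?B = ?Z" by (rule Z'[symmetric])
  finally have "fps_const l * C x = fps_const l * (1 + ?Z) + M * ?Z" .
  then have "fps_nth (fps_const l * C x) n = fps_nth (fps_const l * (1 + ?Z) + M * ?Z) n" by simp
  then show ?thesis
    unfolding M_def by (cases "n = 0") (auto simp: fps_mult_strict_nth C_def)
qed

lemma arch_z_nonneg:
  assumes "0 \<le> l" "\<And>j. 1 \<le> j \<Longrightarrow> 0 \<le> b j"
  shows "0 \<le> arch_z l b n"
proof (induction n rule: less_induct)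
  case (less n)
  show ?case
    by (cases n) (use less assms in \<open>auto intro!: mult_nonneg_nonneg sum_nonneg\<close>)
qed

lemma summable_arch_z:
  assumes l: "0 \<le> l" and b: "\<And>j. 1 \<le> j \<Longrightarrow> 0 \<le> b j" and sb: "summable (\<lambda>j. b (Suc j))"
    and q: "l * (\<Sum>j. b (Suc j)) < 1"
  shows "summable (arch_z l b)"
proof (rule summableI_nonneg_bounded)
  show z0: "0 \<le> arch_z l b n" for n using arch_z_nonneg[OF l b] .
  fix N
  define q where "q = l * (\<Sum>j. b (Suc j))"
  define S where "S = (\<Sum>n<N. arch_z l b n)"
  have S0: "0 \<le> S" unfolding S_def using z0 by (intro sum_nonneg) auto
  have "S \<le> (\<Sum>n<N. (if n = 0 then 1 else 0) + l * (\<Sum>i<n. b (n - i) * arch_z l b i))"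
    unfolding S_def
  proof (rule sum_mono)
    fix n show "arch_z l b n \<le> (if n = 0 then 1 else 0) + l * (\<Sum>i<n. b (n - i) * arch_z l b i)"
      by (cases n) (auto simp: lessThan_Suc_atMost)
  qed
  also have "\<dots> \<le> 1 + l * (\<Sum>n<N. \<Sum>i<n. b (n - i) * arch_z l b i)"
    by (simp add: sum.distrib sum_distrib_left)
  also have "\<dots> \<le> 1 + l * ((\<Sum>j. b (Suc j)) * S)"
    unfolding S_def using l b sb z0
    by (intro add_left_mono mult_left_mono sum_convolution_le) auto
  finally have "S \<le> 1 + q * S" by (simp add: q_def mult.assoc)
  moreover have "q < 1" using q by (simp add: q_def)
  ultimately show "(\<Sum>n<N. arch_z l b n) \<le> 1 / (1 - q)"
    unfolding S_def[symmetric] by (simp add: field_simps)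
qed

text \<open>Here \<open>x m\<close> and \<open>\<eta> m\<close> stand for the process and the innovation \<open>m\<close> steps back in time. The most recent
  value left in the remainder is \<open>x (Suc n)\<close>, and its total weight is \<open>impulse b \<eta> (Suc n)\<close>; replacing it
  by means of the recursion is the induction step.\<close>

lemma arch_backward_iteration:
  fixes x \<eta> b :: "nat \<Rightarrow> real"
  assumes s: "\<And>m. summable (\<lambda>j. b (Suc j) * x (m + Suc j))"
    and x: "\<And>m. x m = \<eta> m * (a + (\<Sum>j. b (Suc j) * x (m + Suc j)))"
  shows "summable (\<lambda>i. (\<Sum>m\<le>n. \<eta> m * impulse b \<eta> m * b (Suc n + i - m)) * x (Suc n + i))"
    and "x 0 = a * (\<Sum>m\<le>n. \<eta> m * impulse b \<eta> m)
           + (\<Sum>i. (\<Sum>m\<le>n. \<eta> m * impulse b \<eta> m * b (Suc n + i - m)) * x (Suc n + i))"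
proof (induction n)
  case 0
  { case 1 show ?case using summable_mult[OF s[of 0], of "\<eta> 0"] by (simp add: mult.assoc) }
  { case 2 show ?case using x[of 0] suminf_mult[OF s[of 0], of "\<eta> 0"] by (simp add: mult.assoc algebra_simps) }
next
  case (Suc n)
  let ?r = "\<lambda>n i. (\<Sum>m\<le>n. \<eta> m * impulse b \<eta> m * b (Suc n + i - m)) * x (Suc n + i)"
  let ?c = "impulse b \<eta> (Suc n)"
  let ?s = "\<lambda>i. b (Suc i) * x (Suc n + Suc i)"
  have eq: "?r (Suc n) i = ?r n (Suc i) + \<eta> (Suc n) * ?c * ?s i" for i
    by (simp add: algebra_simps del: impulse.simps)
  have s1: "summable (\<lambda>i. ?r n (Suc i))" using Suc(1) by (subst summable_Suc_iff)
  have s2: "summable (\<lambda>i. \<eta> (Suc n) * ?c * ?s i)" by (intro summable_mult s)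
  { case 1 show ?case unfolding eq by (intro summable_add s1 s2) }
  { case 2
    have r0: "?r n 0 = ?c * x (Suc n)"
      by (simp add: algebra_simps)
    have "(\<Sum>i. ?r (Suc n) i) = (\<Sum>i. ?r n (Suc i)) + \<eta> (Suc n) * ?c * (\<Sum>i. ?s i)"
      unfolding eq by (subst suminf_add[symmetric, OF s1 s2], subst suminf_mult[OF s]) simp
    also have "(\<Sum>i. ?r n (Suc i)) = (\<Sum>i. ?r n i) - ?r n 0"
      using suminf_split_head[OF Suc(1)] .
    also have "\<dots> = (\<Sum>i. ?r n i) - ?c * x (Suc n)" unfolding r0 ..
    finally show ?case
      using Suc(2) x[of "Suc n"] by (simp add: algebra_simps del: impulse.simps) }
qed

section \<open>Square-integrable functions and series of integrable functions\<close>

lemma integrable_mult_of_squares: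
  fixes f g :: "'a \<Rightarrow> real"
  assumes [measurable]: "f \<in> borel_measurable M" "g \<in> borel_measurable M"
    and f: "integrable M (\<lambda>x. (f x)\<^sup>2)" and g: "integrable M (\<lambda>x. (g x)\<^sup>2)"
  shows "integrable M (\<lambda>x. f x * g x)"
proof (rule Bochner_Integration.integrable_bound[OF Bochner_Integration.integrable_add[OF f g]])
  show "AE x in M. norm (f x * g x) \<le> norm ((f x)\<^sup>2 + (g x)\<^sup>2)"
  proof (rule AE_I2)
    fix x
    have "2 * (\<bar>f x\<bar> * \<bar>g x\<bar>) \<le> \<bar>f x\<bar>\<^sup>2 + \<bar>g x\<bar>\<^sup>2"
      using sum_squares_bound[of "\<bar>f x\<bar>" "\<bar>g x\<bar>"] by (simp only: mult.assoc)
    moreover have "0 \<le> \<bar>f x\<bar> * \<bar>g x\<bar>" by simp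
    ultimately show "norm (f x * g x) \<le> norm ((f x)\<^sup>2 + (g x)\<^sup>2)"
      by (simp add: abs_mult del: mult_nonneg_nonneg)
  qed
qed simp

lemma integrable_square_add:
  fixes f g :: "'a \<Rightarrow> real"
  assumes "f \<in> borel_measurable M" "g \<in> borel_measurable M"
    and "integrable M (\<lambda>x. (f x)\<^sup>2)" "integrable M (\<lambda>x. (g x)\<^sup>2)"
  shows "integrable M (\<lambda>x. (f x + g x)\<^sup>2)"
  unfolding power2_sum mult.assoc
  by (intro Bochner_Integration.integrable_add integrable_mult_right integrable_mult_of_squares assms)

lemma integrable_square_sum:
  fixes f :: "'i \<Rightarrow> 'a \<Rightarrow> real"
  assumes "finite A" "\<And>i. i \<in> A \<Longrightarrow> f i \<in> borel_measurable M"
    and "\<And>i. i \<in> A \<Longrightarrow> integrable M (\<lambda>x. (f i x)\<^sup>2)"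
  shows "integrable M (\<lambda>x. (\<Sum>i\<in>A. f i x)\<^sup>2)"
  using assms
  by (induction A rule: finite_induct) (auto intro!: integrable_square_add borel_measurable_sum)

lemma Cauchy_Schwarz_integral:
  fixes f g :: "'a \<Rightarrow> real"
  assumes [measurable]: "f \<in> borel_measurable M" "g \<in> borel_measurable M"
    and f: "integrable M (\<lambda>x. (f x)\<^sup>2)" and g: "integrable M (\<lambda>x. (g x)\<^sup>2)"
  shows "(\<integral>x. \<bar>f x * g x\<bar> \<partial>M) \<le> sqrt (\<integral>x. (f x)\<^sup>2 \<partial>M) * sqrt (\<integral>x. (g x)\<^sup>2 \<partial>M)"
proof -
  have int: "integrable M (\<lambda>x. \<bar>f x * g x\<bar>)"
    by (intro integrable_abs integrable_mult_of_squares assms)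
  have "(\<integral>\<^sup>+x. ennreal \<bar>f x\<bar> * ennreal \<bar>g x\<bar> \<partial>M)\<^sup>2
      \<le> (\<integral>\<^sup>+x. (ennreal \<bar>f x\<bar>)\<^sup>2 \<partial>M) * (\<integral>\<^sup>+x. (ennreal \<bar>g x\<bar>)\<^sup>2 \<partial>M)"
    by (rule Cauchy_Schwarz_nn_integral) auto
  then have "(\<integral>\<^sup>+x. ennreal \<bar>f x * g x\<bar> \<partial>M)\<^sup>2
      \<le> (\<integral>\<^sup>+x. ennreal ((f x)\<^sup>2) \<partial>M) * (\<integral>\<^sup>+x. ennreal ((g x)\<^sup>2) \<partial>M)"
    by (simp add: ennreal_mult[symmetric] ennreal_power abs_mult)
  then have "ennreal ((\<integral>x. \<bar>f x * g x\<bar> \<partial>M)\<^sup>2) \<le> ennreal ((\<integral>x. (f x)\<^sup>2 \<partial>M) * (\<integral>x. (g x)\<^sup>2 \<partial>M))"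
    using int f g by (simp add: nn_integral_eq_integral ennreal_power ennreal_mult)
  then have "(\<integral>x. \<bar>f x * g x\<bar> \<partial>M)\<^sup>2 \<le> (\<integral>x. (f x)\<^sup>2 \<partial>M) * (\<integral>x. (g x)\<^sup>2 \<partial>M)"
    by (subst (asm) ennreal_le_iff) auto
  then have "(\<integral>x. \<bar>f x * g x\<bar> \<partial>M) \<le> sqrt ((\<integral>x. (f x)\<^sup>2 \<partial>M) * (\<integral>x. (g x)\<^sup>2 \<partial>M))"
    by (rule real_le_rsqrt)
  then show ?thesis by (simp add: real_sqrt_mult)
qed

text \<open>Fubini's theorem for a series of integrable functions, in the form in which only upper bounds for the
  \<open>L\<^sup>1\<close>-norms are known.\<close>

lemma dominated_series:
  fixes f :: "nat \<Rightarrow> 'a \<Rightarrow> real" and d :: "nat \<Rightarrow> real"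
  assumes f [measurable]: "\<And>j. integrable M (f j)"
    and d: "\<And>j. (\<integral>x. \<bar>f j x\<bar> \<partial>M) \<le> d j" and sd: "summable d"
  shows "AE x in M. summable (\<lambda>j. norm (f j x))"
    and "integrable M (\<lambda>x. \<Sum>j. f j x)"
    and "(\<integral>x. (\<Sum>j. f j x) \<partial>M) = (\<Sum>j. \<integral>x. f j x \<partial>M)"
    and "(\<integral>x. \<bar>\<Sum>j. f j x\<bar> \<partial>M) \<le> (\<Sum>j. d j)"
proof -
  have si: "summable (\<lambda>j. \<integral>x. norm (f j x) \<partial>M)"
    using d by (intro summable_comparison_test'[OF sd, of 0]) auto
  show AE: "AE x in M. summable (\<lambda>j. norm (f j x))"
  proof -
    have "(\<integral>\<^sup>+x. (\<Sum>j. ennreal (norm (f j x))) \<partial>M) = (\<Sum>j. \<integral>\<^sup>+x. ennreal (norm (f j x)) \<partial>M)"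
      by (rule nn_integral_suminf) auto
    also have "\<dots> = (\<Sum>j. ennreal (\<integral>x. norm (f j x) \<partial>M))"
      using f by (intro arg_cong[where f = suminf] ext nn_integral_eq_integral) auto
    also have "\<dots> = ennreal (\<Sum>j. \<integral>x. norm (f j x) \<partial>M)"
      using si by (intro suminf_ennreal2) auto
    finally have "(\<integral>\<^sup>+x. (\<Sum>j. ennreal (norm (f j x))) \<partial>M) \<noteq> \<infinity>" by simp
    then have "AE x in M. (\<Sum>j. ennreal (norm (f j x))) \<noteq> \<infinity>"
      by (intro nn_integral_PInf_AE) auto
    then show ?thesis by eventually_elim (auto intro: summable_suminf_not_top)
  qed
  show int: "integrable M (\<lambda>x. \<Sum>j. f j x)" using integrable_suminf[OF f AE si] .
  show "(\<integral>x. (\<Sum>j. f j x) \<partial>M) = (\<Sum>j. \<integral>x. f j x \<partial>M)" using integral_suminf[OF f AE si] .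
  have AE': "AE x in M. summable (\<lambda>j. norm (norm (f j x)))" using AE by simp
  have si': "summable (\<lambda>j. \<integral>x. norm (norm (f j x)) \<partial>M)" using si by simp
  note f' = integrable_norm[OF f]
  have "(\<integral>x. \<bar>\<Sum>j. f j x\<bar> \<partial>M) \<le> (\<integral>x. (\<Sum>j. norm (f j x)) \<partial>M)"
  proof (rule integral_mono_AE)
    show "integrable M (\<lambda>x. \<bar>\<Sum>j. f j x\<bar>)" using int by simp
    show "integrable M (\<lambda>x. \<Sum>j. norm (f j x))" using integrable_suminf[OF f' AE' si'] .
    show "AE x in M. \<bar>\<Sum>j. f j x\<bar> \<le> (\<Sum>j. norm (f j x))"
      using AE by eventually_elim (auto dest: summable_rabs)
  qed
  also have "\<dots> = (\<Sum>j. \<integral>x. norm (f j x) \<partial>M)" using integral_suminf[OF f' AE' si'] .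
  also have "\<dots> \<le> (\<Sum>j. d j)" using d by (intro suminf_le si sd) auto
  finally show "(\<integral>x. \<bar>\<Sum>j. f j x\<bar> \<partial>M) \<le> (\<Sum>j. d j)" .
qed

section \<open>Independence of coordinates\<close>

text \<open>A functional that depends only on the coordinates in \<open>A\<close> factors through the restriction to \<open>A\<close>: extend
  the restricted path by 0. This lets functionals be given on whole paths, with their dependence expressed
  as an invariance.\<close>

lemma (in prob_space) indep_var_function_of_others:
  fixes X :: "'i \<Rightarrow> 'a \<Rightarrow> real" and G :: "('i \<Rightarrow> real) \<Rightarrow> real"
  assumes X: "indep_vars (\<lambda>_. borel) X UNIV"
    and G [measurable]: "G \<in> borel_measurable (PiM UNIV (\<lambda>_. borel))"
    and m: "m \<notin> A" and cong: "\<And>x y. (\<And>i. i \<in> A \<Longrightarrow> x i = y i) \<Longrightarrow> G x = G y"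
  shows "indep_var borel (X m) borel (\<lambda>\<omega>. G (\<lambda>i. X i \<omega>))"
proof -
  define P where "P x = (\<lambda>i. if i \<in> A then x i else 0)" for x :: "'i \<Rightarrow> real"
  have P: "P \<in> measurable (PiM A (\<lambda>_. borel)) (PiM UNIV (\<lambda>_. borel))"
  proof (rule measurable_PiM_single')
    show "(\<lambda>x. P x i) \<in> borel_measurable (PiM A (\<lambda>_. borel))" for i
      by (cases "i \<in> A") (auto simp: P_def)
  qed auto
  have "indep_var (PiM {m} (\<lambda>_. borel)) (\<lambda>\<omega>. restrict (\<lambda>i. X i \<omega>) {m})
          (PiM A (\<lambda>_. borel)) (\<lambda>\<omega>. restrict (\<lambda>i. X i \<omega>) A)"
    using m by (intro indep_var_restrict[OF X]) auto
  from indep_var_compose[OF this, of "\<lambda>x. x m" borel "G \<circ> P" borel]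
  have "indep_var borel ((\<lambda>x. x m) \<circ> (\<lambda>\<omega>. restrict (\<lambda>i. X i \<omega>) {m}))
          borel ((G \<circ> P) \<circ> (\<lambda>\<omega>. restrict (\<lambda>i. X i \<omega>) A))"
    using measurable_comp[OF P G] by (simp add: comp_def)
  moreover have "G (P (restrict (\<lambda>i. X i \<omega>) A)) = G (\<lambda>i. X i \<omega>)" for \<omega>
    by (rule cong) (simp add: P_def)
  ultimately show ?thesis by (simp add: comp_def)
qed

lemma (in prob_space) indep_vars_reindex:
  assumes X: "indep_vars (\<lambda>_. N) X UNIV" and f: "inj f"
  shows "indep_vars (\<lambda>_. N) (\<lambda>j. X (f j)) UNIV"
proof -
  have "indep_vars (\<lambda>j. PiM {f j} (\<lambda>_. N)) (\<lambda>j \<omega>. restrict (\<lambda>i. X i \<omega>) {f j}) UNIV"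
    using f by (intro indep_vars_restrict[OF X]) (auto simp: disjoint_family_on_def inj_def)
  then have "indep_vars (\<lambda>_. N) (\<lambda>j \<omega>. (\<lambda>x. x (f j)) (restrict (\<lambda>i. X i \<omega>) {f j})) UNIV"
    by (rule indep_vars_compose2) auto
  then show ?thesis by simp
qed

lemma (in prob_space) indep_square_mult:
  fixes X Y :: "'a \<Rightarrow> real"
  assumes ind: "indep_var borel X borel Y"
    and X: "integrable M (\<lambda>\<omega>. (X \<omega>)\<^sup>2)" and Y: "integrable M (\<lambda>\<omega>. (Y \<omega>)\<^sup>2)"
  shows "integrable M (\<lambda>\<omega>. (X \<omega> * Y \<omega>)\<^sup>2)"
    and "expectation (\<lambda>\<omega>. (X \<omega> * Y \<omega>)\<^sup>2) = expectation (\<lambda>\<omega>. (X \<omega>)\<^sup>2) * expectation (\<lambda>\<omega>. (Y \<omega>)\<^sup>2)"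
proof -
  have "indep_var borel ((\<lambda>x. x\<^sup>2) \<circ> X) borel ((\<lambda>x. x\<^sup>2) \<circ> Y)"
    by (rule indep_var_compose[OF ind]) auto
  then have *: "indep_var borel (\<lambda>\<omega>. (X \<omega>)\<^sup>2) borel (\<lambda>\<omega>. (Y \<omega>)\<^sup>2)" by (simp add: comp_def)
  show "integrable M (\<lambda>\<omega>. (X \<omega> * Y \<omega>)\<^sup>2)"
    unfolding power_mult_distrib by (rule indep_var_integrable[OF * X Y])
  show "expectation (\<lambda>\<omega>. (X \<omega> * Y \<omega>)\<^sup>2) = expectation (\<lambda>\<omega>. (X \<omega>)\<^sup>2) * expectation (\<lambda>\<omega>. (Y \<omega>)\<^sup>2)"
    unfolding power_mult_distrib by (rule indep_var_lebesgue_integral[OF * X Y])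
qed

section \<open>Second moments of impulse responses\<close>

lemma borel_measurable_impulse [measurable]:
  assumes [measurable]: "\<And>j. f j \<in> borel_measurable N"
  shows "(\<lambda>\<omega>. impulse b (\<lambda>j. f j \<omega>) n) \<in> borel_measurable N"
proof (induction n rule: less_induct)
  case (less n)
  show ?case
  proof (cases "n = 0")
    case False
    then show ?thesis
      using less by (simp add: impulse_pos)
  qed simp
qed

locale iid_square_integrable = prob_space M for M :: "'a measure" +
  fixes \<eta> :: "nat \<Rightarrow> 'a \<Rightarrow> real" and l v :: real
  assumes indep: "indep_vars (\<lambda>_. borel) \<eta> UNIV"
    and square_integrable: "\<And>n. integrable M (\<lambda>\<omega>. (\<eta> n \<omega>)\<^sup>2)"
    and mean: "\<And>n. expectation (\<eta> n) = l"
    and variance: "\<And>n. expectation (\<lambda>\<omega>. (\<eta> n \<omega> - l)\<^sup>2) = v"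
begin

lemma measurable_\<eta> [measurable]: "\<eta> n \<in> borel_measurable M"
  using indep unfolding indep_vars_def by auto

lemma integrable_\<eta>: "integrable M (\<eta> n)"
  using square_integrable by (rule square_integrable_imp_integrable[OF measurable_\<eta>])

abbreviation imp :: "(nat \<Rightarrow> real) \<Rightarrow> nat \<Rightarrow> 'a \<Rightarrow> real" where
  "imp b n \<omega> \<equiv> impulse b (\<lambda>j. \<eta> j \<omega>) n"

lemma indep_past:
  assumes "G \<in> borel_measurable (PiM UNIV (\<lambda>_. borel))"
    and "\<And>x y. (\<And>i. i < n \<Longrightarrow> x i = y i) \<Longrightarrow> G x = G y"
  shows "indep_var borel (\<eta> n) borel (\<lambda>\<omega>. G (\<lambda>i. \<eta> i \<omega>))"
proof (rule indep_var_function_of_others[OF indep assms(1)])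
  show "n \<notin> {..<n}" by simp
  show "G x = G y" if "\<And>i. i \<in> {..<n} \<Longrightarrow> x i = y i" for x y
    by (rule assms(2), rule that) simp
qed

lemma centered_indep_past:
  assumes "G \<in> borel_measurable (PiM UNIV (\<lambda>_. borel))"
    and "\<And>x y. (\<And>i. i < n \<Longrightarrow> x i = y i) \<Longrightarrow> G x = G y"
  shows "indep_var borel (\<lambda>\<omega>. \<eta> n \<omega> - l) borel (\<lambda>\<omega>. G (\<lambda>i. \<eta> i \<omega>))"
proof -
  have "indep_var borel (\<eta> n) borel (\<lambda>\<omega>. G (\<lambda>i. \<eta> i \<omega>))"
    using assms by (rule indep_past)
  then have "indep_var borel ((\<lambda>x. x - l) \<circ> \<eta> n) borel ((\<lambda>x. x) \<circ> (\<lambda>\<omega>. G (\<lambda>i. \<eta> i \<omega>)))"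
    by (rule indep_var_compose) auto
  then show ?thesis unfolding comp_def .
qed

lemma integrable_centered_square: "integrable M (\<lambda>\<omega>. (\<eta> n \<omega> - l)\<^sup>2)"
  using integrable_square_add[of "\<eta> n" M "\<lambda>_. - l"] square_integrable by simp

lemma square_moment_\<eta>: "expectation (\<lambda>\<omega>. (\<eta> n \<omega>)\<^sup>2) = v + l\<^sup>2"
proof -
  have "v = expectation (\<lambda>\<omega>. (\<eta> n \<omega>)\<^sup>2 - (2 * l) * \<eta> n \<omega> + l\<^sup>2)"
    unfolding variance[of n, symmetric] by (simp add: power2_diff algebra_simps)
  also have "\<dots> = expectation (\<lambda>\<omega>. (\<eta> n \<omega>)\<^sup>2) - (2 * l) * l + l\<^sup>2"
    using integrable_\<eta> square_integrable by (simp add: mean prob_space)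
  finally show ?thesis by (simp add: power2_eq_square)
qed

lemma indep_impulse: "indep_var borel (\<eta> n) borel (imp b n)"
  by (rule indep_past) (auto intro: impulse_cong intro!: borel_measurable_impulse)

lemma integrable_impulse_square: "integrable M (\<lambda>\<omega>. (imp b n \<omega>)\<^sup>2)"
proof (induction n rule: less_induct)
  case (less n)
  show ?case
  proof (cases "n = 0")
    case False
    have "integrable M (\<lambda>\<omega>. (\<Sum>j<n. b (n - j) * (\<eta> j \<omega> * imp b j \<omega>))\<^sup>2)"
    proof (rule integrable_square_sum)
      fix j assume "j \<in> {..<n}"
      then have "integrable M (\<lambda>\<omega>. (\<eta> j \<omega> * imp b j \<omega>)\<^sup>2)"
        using less by (intro indep_square_mult indep_impulse square_integrable) auto
      then show "integrable M (\<lambda>\<omega>. (b (n - j) * (\<eta> j \<omega> * imp b j \<omega>))\<^sup>2)"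
        by (subst power_mult_distrib) simp
    qed auto
    then show ?thesis using False by (simp add: impulse_pos mult.assoc)
  qed simp
qed

lemma square_moment_response:
  "integrable M (\<lambda>\<omega>. (\<eta> n \<omega> * imp b n \<omega>)\<^sup>2)"
  "expectation (\<lambda>\<omega>. (\<eta> n \<omega> * imp b n \<omega>)\<^sup>2) = (v + l\<^sup>2) * expectation (\<lambda>\<omega>. (imp b n \<omega>)\<^sup>2)"
  using indep_square_mult[OF indep_impulse square_integrable integrable_impulse_square]
  by (simp_all add: square_moment_\<eta>)

abbreviation noise :: "(nat \<Rightarrow> real) \<Rightarrow> nat \<Rightarrow> 'a \<Rightarrow> real" where
  "noise b n \<omega> \<equiv> (\<eta> n \<omega> - l) * imp b n \<omega>"

lemma
  shows integrable_noise_square: "integrable M (\<lambda>\<omega>. (noise b n \<omega>)\<^sup>2)"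
    and noise_square: "expectation (\<lambda>\<omega>. (noise b n \<omega>)\<^sup>2) = v * expectation (\<lambda>\<omega>. (imp b n \<omega>)\<^sup>2)"
proof -
  have "indep_var borel (\<lambda>\<omega>. \<eta> n \<omega> - l) borel (imp b n)"
    by (rule centered_indep_past) (auto intro: impulse_cong intro!: borel_measurable_impulse)
  note * = indep_square_mult[OF this integrable_centered_square integrable_impulse_square]
  from * show "integrable M (\<lambda>\<omega>. (noise b n \<omega>)\<^sup>2)"
    "expectation (\<lambda>\<omega>. (noise b n \<omega>)\<^sup>2) = v * expectation (\<lambda>\<omega>. (imp b n \<omega>)\<^sup>2)"
    by (simp_all add: variance)
qed

lemma noise_mult_integrable: "integrable M (\<lambda>\<omega>. noise b i \<omega> * noise b j \<omega>)"
  by (intro integrable_mult_of_squares integrable_noise_square) auto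

text \<open>The sequence \<open>noise b\<close> consists of martingale differences: the factor \<open>\<eta> j - l\<close> is centered and
  independent of everything that precedes it.\<close>

lemma noise_orthogonal:
  assumes "i < j"
  shows "expectation (\<lambda>\<omega>. noise b i \<omega> * noise b j \<omega>) = 0"
proof -
  let ?G = "\<lambda>x. (x i - l) * impulse b x i * impulse b x j"
  have ind: "indep_var borel (\<lambda>\<omega>. \<eta> j \<omega> - l) borel (\<lambda>\<omega>. ?G (\<lambda>i. \<eta> i \<omega>))"
  proof (rule centered_indep_past)
    show "?G \<in> borel_measurable (PiM UNIV (\<lambda>_. borel))"
      using borel_measurable_impulse[of "\<lambda>i x. x i" "PiM UNIV (\<lambda>_. borel)" b] by simp
    show "?G x = ?G y" if "\<And>m. m < j \<Longrightarrow> x m = y m" for x y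
      using that assms impulse_cong[of i x y b] impulse_cong[of j x y b] by simp
  qed
  have "integrable M (\<lambda>\<omega>. noise b i \<omega> * imp b j \<omega>)"
    by (intro integrable_mult_of_squares integrable_noise_square integrable_impulse_square) auto
  from indep_var_lebesgue_integral[OF ind _ this]
  have "expectation (\<lambda>\<omega>. (\<eta> j \<omega> - l) * ?G (\<lambda>i. \<eta> i \<omega>)) = 0"
    using integrable_\<eta> by (simp add: mean prob_space)
  then show ?thesis by (simp add: mult_ac)
qed

lemma noise_mean: "expectation (noise b i) = 0"
proof -
  have "indep_var borel (\<lambda>\<omega>. \<eta> i \<omega> - l) borel (imp b i)"
    by (rule centered_indep_past) (auto intro: impulse_cong intro!: borel_measurable_impulse)
  moreover have "integrable M (imp b i)"
    by (rule square_integrable_imp_integrable[OF _ integrable_impulse_square]) simp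
  ultimately show ?thesis
    using indep_var_lebesgue_integral[of "\<lambda>\<omega>. \<eta> i \<omega> - l" "imp b i"] integrable_\<eta>
    by (simp add: mean prob_space)
qed

text \<open>In the variation-of-constants formula the random terms are centered and mutually orthogonal, so their
  second moments add up.\<close>

lemma second_moment_renewal:
  "l\<^sup>2 * expectation (\<lambda>\<omega>. (imp b n \<omega>)\<^sup>2)
     = (l * arch_z l b n)\<^sup>2 + (\<Sum>i<n. v * (arch_z l b (n - i))\<^sup>2 * expectation (\<lambda>\<omega>. (imp b i \<omega>)\<^sup>2))"
proof -
  let ?z = "arch_z l b"
  let ?S = "\<lambda>\<omega>. \<Sum>i<n. ?z (n - i) * noise b i \<omega>"
  have nint: "integrable M (noise b i)" for i
    by (rule square_integrable_imp_integrable[OF _ integrable_noise_square]) simp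
  have cov: "expectation (\<lambda>\<omega>. noise b i \<omega> * noise b j \<omega>)
      = (if i = j then v * expectation (\<lambda>\<omega>. (imp b i \<omega>)\<^sup>2) else 0)" for i j
    using noise_orthogonal[where i = i and j = j and b = b] noise_orthogonal[where i = j and j = i and b = b]
      noise_square[where b = b and n = i]
    by (cases i j rule: linorder_cases) (auto simp: mult.commute power2_eq_square)
  have S1: "integrable M ?S" "expectation ?S = 0"
    using nint by (auto simp: noise_mean)
  have S2: "(?S \<omega>)\<^sup>2 = (\<Sum>i<n. \<Sum>j<n. ?z (n - i) * ?z (n - j) * (noise b i \<omega> * noise b j \<omega>))" for \<omega>
    by (simp add: power2_eq_square sum_product mult_ac)
  have S2int: "integrable M (\<lambda>\<omega>. (?S \<omega>)\<^sup>2)"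
    unfolding S2 by (intro Bochner_Integration.integrable_sum integrable_mult_right noise_mult_integrable)
  have "expectation (\<lambda>\<omega>. (?S \<omega>)\<^sup>2)
      = (\<Sum>i<n. \<Sum>j<n. ?z (n - i) * ?z (n - j) * expectation (\<lambda>\<omega>. noise b i \<omega> * noise b j \<omega>))"
    unfolding S2 using noise_mult_integrable[where b = b]
    by (subst Bochner_Integration.integral_sum) (auto intro!: sum.cong Bochner_Integration.integral_sum)
  also have "\<dots> = (\<Sum>i<n. v * (?z (n - i))\<^sup>2 * expectation (\<lambda>\<omega>. (imp b i \<omega>)\<^sup>2))"
    unfolding cov by (rule sum.cong) (auto simp: if_distrib power2_eq_square mult_ac cong: if_cong)
  finally have E2: "expectation (\<lambda>\<omega>. (?S \<omega>)\<^sup>2) = \<dots>" .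
  have "l\<^sup>2 * expectation (\<lambda>\<omega>. (imp b n \<omega>)\<^sup>2) = expectation (\<lambda>\<omega>. (l * imp b n \<omega>)\<^sup>2)"
    by (simp add: power_mult_distrib)
  also have "\<dots> = expectation (\<lambda>\<omega>. (l * ?z n)\<^sup>2 + 2 * (l * ?z n) * ?S \<omega> + (?S \<omega>)\<^sup>2)"
    by (rule arg_cong[where f = expectation], rule ext, subst impulse_perturbation) (simp only: power2_sum ac_simps)
  also have "\<dots> = (l * ?z n)\<^sup>2 + expectation (\<lambda>\<omega>. (?S \<omega>)\<^sup>2)"
    using S1 S2int by (simp add: prob_space)
  finally show ?thesis unfolding E2 .
qed

text \<open>The kernel of the renewal equation for the second moments has mass \<open>\<Omega>\<^sup>2 < 1\<close>, and its square root is a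
  multiple of the summable sequence \<open>z\<close>.\<close>

lemma summable_impulse_norm:
  assumes l: "0 < l" and v: "0 \<le> v"
    and z0: "\<And>n. 0 \<le> arch_z l b n" and z: "summable (arch_z l b)"
    and \<Omega>: "sqrt v / l * sqrt (\<Sum>j. (arch_z l b (Suc j))\<^sup>2) < 1"
  shows "summable (\<lambda>n. sqrt (expectation (\<lambda>\<omega>. (imp b n \<omega>)\<^sup>2)))"
proof (rule summable_sqrt_renewal)
  let ?z = "arch_z l b"
  have zS: "summable (\<lambda>n. ?z (Suc n))" using z by (subst summable_Suc_iff)
  have z2: "summable (\<lambda>n. (?z (Suc n))\<^sup>2)"
  proof (rule summable_comparison_test_ev[OF _ zS])
    show "\<forall>\<^sub>F n in sequentially. norm ((?z (Suc n))\<^sup>2) \<le> ?z (Suc n)"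
      using order_tendstoD(2)[OF summable_LIMSEQ_zero[OF zS] zero_less_one]
    proof (rule eventually_mono)
      fix n assume "?z (Suc n) < 1"
      then show "norm ((?z (Suc n))\<^sup>2) \<le> ?z (Suc n)"
        using z0[of "Suc n"] mult_left_le[of "?z (Suc n)" "?z (Suc n)"]
        by (simp add: power2_eq_square del: arch_z.simps)
    qed
  qed
  show "summable (\<lambda>n. sqrt ((?z n)\<^sup>2))" using z z0 by simp
  show "summable (\<lambda>n. sqrt (v / l\<^sup>2 * (?z (Suc n))\<^sup>2))"
    using zS z0 by (simp add: real_sqrt_mult real_sqrt_divide summable_mult summable_divide del: arch_z.simps)
  show "summable (\<lambda>n. v / l\<^sup>2 * (?z (Suc n))\<^sup>2)" by (intro summable_mult z2)
  show "(\<Sum>n. v / l\<^sup>2 * (?z (Suc n))\<^sup>2) < 1"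
  proof -
    have "0 \<le> sqrt v / l * sqrt (\<Sum>j. (?z (Suc j))\<^sup>2)"
      using l v suminf_nonneg[OF z2] by simp
    then have "(sqrt v / l * sqrt (\<Sum>j. (?z (Suc j))\<^sup>2))\<^sup>2 < 1"
      using \<Omega> by (simp add: power_less_one_iff del: arch_z.simps)
    moreover have "(sqrt v / l * sqrt (\<Sum>j. (?z (Suc j))\<^sup>2))\<^sup>2 = v / l\<^sup>2 * (\<Sum>j. (?z (Suc j))\<^sup>2)"
      using v suminf_nonneg[OF z2] by (simp add: power_mult_distrib power_divide del: arch_z.simps)
    ultimately show ?thesis by (subst suminf_mult[OF z2]) simp
  qed
  show "expectation (\<lambda>\<omega>. (imp b n \<omega>)\<^sup>2)
      = (?z n)\<^sup>2 + (\<Sum>i<n. v / l\<^sup>2 * (?z (n - i))\<^sup>2 * expectation (\<lambda>\<omega>. (imp b i \<omega>)\<^sup>2))" for n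
  proof -
    have "l\<^sup>2 * expectation (\<lambda>\<omega>. (imp b n \<omega>)\<^sup>2)
      = l\<^sup>2 * ((?z n)\<^sup>2 + (\<Sum>i<n. v / l\<^sup>2 * (?z (n - i))\<^sup>2 * expectation (\<lambda>\<omega>. (imp b i \<omega>)\<^sup>2)))"
      unfolding second_moment_renewal using l
      by (simp add: distrib_left sum_distrib_left power_mult_distrib)
    then show ?thesis using l by simp
  qed
qed (use v in auto)

text \<open>Backward iteration with a vanishing remainder. Nothing is known about the joint law of \<open>x\<close> and \<open>\<eta>\<close>, so
  each term of the remainder is bounded by a product of \<open>L\<^sup>2\<close>-norms. The sum of these bounds is at most a
  tail of the convolution of \<open>b\<close> with the norms of \<open>\<eta> m * imp b m\<close>, a convergent series. The convergence
  thus obtained is in \<open>L\<^sup>1\<close>; a subsequence converges almost surely.\<close>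

lemma causal_representation:
  fixes x :: "nat \<Rightarrow> 'a \<Rightarrow> real"
  assumes b0: "\<And>j. 1 \<le> j \<Longrightarrow> 0 \<le> b j" and sb: "summable (\<lambda>j. b (Suc j))"
    and norms: "summable (\<lambda>n. sqrt (expectation (\<lambda>\<omega>. (imp b n \<omega>)\<^sup>2)))"
    and x [measurable]: "\<And>m. x m \<in> borel_measurable M"
    and x2: "\<And>m. integrable M (\<lambda>\<omega>. (x m \<omega>)\<^sup>2)" "\<And>m. expectation (\<lambda>\<omega>. (x m \<omega>)\<^sup>2) = C"
    and eq: "\<And>m. AE \<omega> in M. summable (\<lambda>j. b (Suc j) * x (m + Suc j) \<omega>) \<and>
        x m \<omega> = \<eta> m \<omega> * (a + (\<Sum>j. b (Suc j) * x (m + Suc j) \<omega>))"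
  shows "\<exists>r :: nat \<Rightarrow> nat. AE \<omega> in M. (\<lambda>n. a * (\<Sum>m\<le>r n. \<eta> m \<omega> * imp b m \<omega>)) \<longlonglongrightarrow> x 0 \<omega>"
proof -
  define s where "s m = sqrt (expectation (\<lambda>\<omega>. (\<eta> m \<omega> * imp b m \<omega>)\<^sup>2))" for m
  define d where "d i = (\<Sum>m<i. b (i - m) * s m)" for i
  define r where "r n i \<omega> = (\<Sum>m\<le>n. \<eta> m \<omega> * imp b m \<omega> * b (Suc n + i - m)) * x (Suc n + i) \<omega>" for n i \<omega>
  define u where "u n \<omega> = x 0 \<omega> - a * (\<Sum>m\<le>n. \<eta> m \<omega> * imp b m \<omega>)" for n \<omega>
  have C0: "0 \<le> C" unfolding x2(2)[of 0, symmetric] by simp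
  have s0: "0 \<le> s m" for m by (simp add: s_def)
  have "summable s"
    unfolding s_def square_moment_response(2) real_sqrt_mult by (intro summable_mult norms)
  then have sd: "summable d"
    unfolding d_def using b0 sb s0 by (intro summable_convolution) auto
  have resp: "integrable M (\<lambda>\<omega>. \<eta> m \<omega> * imp b m \<omega>)" for m
    by (rule square_integrable_imp_integrable[OF _ square_moment_response(1)]) simp
  have int: "integrable M (\<lambda>\<omega>. \<eta> m \<omega> * imp b m \<omega> * x j \<omega>)" for m j
    by (intro integrable_mult_of_squares square_moment_response x2) auto
  have r_eq: "r n i \<omega> = (\<Sum>m\<le>n. b (Suc n + i - m) * (\<eta> m \<omega> * imp b m \<omega> * x (Suc n + i) \<omega>))" for n i \<omega>
    unfolding r_def sum_distrib_right by (simp add: mult_ac)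
  have rint: "integrable M (r n i)" for n i
    unfolding r_eq by (intro Bochner_Integration.integrable_sum integrable_mult_right int)
  have rle: "(\<integral>\<omega>. \<bar>r n i \<omega>\<bar> \<partial>M) \<le> d (Suc n + i) * sqrt C" for n i
  proof -
    have "(\<integral>\<omega>. \<bar>r n i \<omega>\<bar> \<partial>M)
        \<le> (\<integral>\<omega>. (\<Sum>m\<le>n. b (Suc n + i - m) * \<bar>\<eta> m \<omega> * imp b m \<omega> * x (Suc n + i) \<omega>\<bar>) \<partial>M)"
    proof (rule integral_mono)
      show "integrable M (\<lambda>\<omega>. \<bar>r n i \<omega>\<bar>)" using rint by simp
      show "integrable M (\<lambda>\<omega>. \<Sum>m\<le>n. b (Suc n + i - m) * \<bar>\<eta> m \<omega> * imp b m \<omega> * x (Suc n + i) \<omega>\<bar>)"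
        by (intro Bochner_Integration.integrable_sum integrable_mult_right integrable_abs int)
      fix \<omega>
      have "\<bar>r n i \<omega>\<bar> \<le> (\<Sum>m\<le>n. \<bar>b (Suc n + i - m) * (\<eta> m \<omega> * imp b m \<omega> * x (Suc n + i) \<omega>)\<bar>)"
        unfolding r_eq by (rule sum_abs)
      also have "\<dots> = (\<Sum>m\<le>n. b (Suc n + i - m) * \<bar>\<eta> m \<omega> * imp b m \<omega> * x (Suc n + i) \<omega>\<bar>)"
      proof (rule sum.cong)
        fix m assume "m \<in> {..n}"
        then have "0 \<le> b (Suc n + i - m)" by (intro b0) auto
        then show "\<bar>b (Suc n + i - m) * (\<eta> m \<omega> * imp b m \<omega> * x (Suc n + i) \<omega>)\<bar>
            = b (Suc n + i - m) * \<bar>\<eta> m \<omega> * imp b m \<omega> * x (Suc n + i) \<omega>\<bar>"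
          by (simp only: abs_mult abs_of_nonneg)
      qed simp
      finally show "\<bar>r n i \<omega>\<bar> \<le> (\<Sum>m\<le>n. b (Suc n + i - m) * \<bar>\<eta> m \<omega> * imp b m \<omega> * x (Suc n + i) \<omega>\<bar>)" .
    qed
    also have "\<dots> = (\<Sum>m\<le>n. b (Suc n + i - m) * (\<integral>\<omega>. \<bar>\<eta> m \<omega> * imp b m \<omega> * x (Suc n + i) \<omega>\<bar> \<partial>M))"
      by (subst Bochner_Integration.integral_sum) (auto intro!: integrable_mult_right integrable_abs int)
    also have "\<dots> \<le> (\<Sum>m\<le>n. b (Suc n + i - m) * (s m * sqrt C))"
    proof (rule sum_mono)
      fix m assume "m \<in> {..n}"
      then have "0 \<le> b (Suc n + i - m)" by (intro b0) auto
      then show "b (Suc n + i - m) * (\<integral>\<omega>. \<bar>\<eta> m \<omega> * imp b m \<omega> * x (Suc n + i) \<omega>\<bar> \<partial>M)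
          \<le> b (Suc n + i - m) * (s m * sqrt C)"
        unfolding s_def x2(2)[of "Suc n + i", symmetric]
        by (intro mult_left_mono Cauchy_Schwarz_integral square_moment_response x2) auto
    qed
    \<comment> \<open>the extra terms with \<open>n < m\<close> complete a coefficient of the convolution\<close>
    also have "\<dots> \<le> (\<Sum>m<Suc n + i. b (Suc n + i - m) * (s m * sqrt C))"
    proof (rule sum_mono2)
      fix m assume "m \<in> {..<Suc n + i} - {..n}"
      then have "0 \<le> b (Suc n + i - m)" by (intro b0) auto
      then show "0 \<le> b (Suc n + i - m) * (s m * sqrt C)" using s0 C0 by simp
    qed auto
    also have "\<dots> = d (Suc n + i) * sqrt C"
      unfolding d_def sum_distrib_right by (simp only: mult.assoc)
    finally show ?thesis .
  qed
  have sd': "summable (\<lambda>i. d (Suc n + i) * sqrt C)" for n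
    using summable_mult2[OF summable_ignore_initial_segment[OF sd, of "Suc n"]]
    by (simp only: add.commute[of _ "Suc n"])
  have AE: "AE \<omega> in M. \<forall>n. u n \<omega> = (\<Sum>i. r n i \<omega>)"
  proof -
    have "AE \<omega> in M. \<forall>m. summable (\<lambda>j. b (Suc j) * x (m + Suc j) \<omega>) \<and>
        x m \<omega> = \<eta> m \<omega> * (a + (\<Sum>j. b (Suc j) * x (m + Suc j) \<omega>))"
      using eq by (subst AE_all_countable) auto
    then show ?thesis
    proof eventually_elim
      case (elim \<omega>)
      have s: "summable (\<lambda>j. b (Suc j) * x (m + Suc j) \<omega>)"
        and e: "x m \<omega> = \<eta> m \<omega> * (a + (\<Sum>j. b (Suc j) * x (m + Suc j) \<omega>))" for m
        using elim by blast+
      show ?case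
      proof
        fix n
        show "u n \<omega> = (\<Sum>i. r n i \<omega>)"
          unfolding u_def r_def
          using arch_backward_iteration(2)[of b "\<lambda>m. x m \<omega>" "\<lambda>m. \<eta> m \<omega>" a n, OF s e] by linarith
      qed
    qed
  qed
  have x0: "integrable M (x 0)" by (rule square_integrable_imp_integrable[OF x x2(1)])
  have uint: "integrable M (u n)" for n
    unfolding u_def using x0 resp by auto
  have ule: "(\<integral>\<omega>. norm (u n \<omega>) \<partial>M) \<le> (\<Sum>i. d (i + Suc n)) * sqrt C" for n
  proof -
    have "(\<integral>\<omega>. norm (u n \<omega>) \<partial>M) = (\<integral>\<omega>. \<bar>\<Sum>i. r n i \<omega>\<bar> \<partial>M)"
      using AE uint[of n] rint by (intro integral_cong_AE) auto
    also have "\<dots> \<le> (\<Sum>i. d (Suc n + i) * sqrt C)"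
      by (rule dominated_series(4)[OF rint rle sd'])
    also have "\<dots> = (\<Sum>i. d (i + Suc n)) * sqrt C"
      using suminf_mult2[OF summable_ignore_initial_segment[OF sd, of "Suc n"], of "sqrt C"]
      by (simp only: add.commute[of _ "Suc n"])
    finally show ?thesis .
  qed
  have "(\<lambda>n. (\<Sum>i. d (i + Suc n)) * sqrt C) \<longlonglongrightarrow> 0 * sqrt C"
    by (intro tendsto_mult tendsto_const LIMSEQ_Suc[OF suminf_exist_split2[OF sd]])
  then have lim: "(\<lambda>n. (\<Sum>i. d (i + Suc n)) * sqrt C) \<longlonglongrightarrow> 0" by simp
  have "(\<lambda>n. \<integral>\<omega>. norm (u n \<omega>) \<partial>M) \<longlonglongrightarrow> 0"
  proof (rule tendsto_sandwich[OF _ _ tendsto_const lim])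
    show "\<forall>\<^sub>F n in sequentially. 0 \<le> (\<integral>\<omega>. norm (u n \<omega>) \<partial>M)" by simp
    show "\<forall>\<^sub>F n in sequentially. (\<integral>\<omega>. norm (u n \<omega>) \<partial>M) \<le> (\<Sum>i. d (i + Suc n)) * sqrt C"
      by (rule always_eventually, rule allI, rule ule)
  qed
  from tendsto_L1_AE_subseq[OF uint this] obtain k
    where "AE \<omega> in M. (\<lambda>n. u (k n) \<omega>) \<longlonglongrightarrow> 0" by auto
  then have "AE \<omega> in M. (\<lambda>n. a * (\<Sum>m\<le>k n. \<eta> m \<omega> * imp b m \<omega>)) \<longlonglongrightarrow> x 0 \<omega>"
  proof eventually_elim
    case (elim \<omega>)
    from tendsto_diff[OF tendsto_const[of "x 0 \<omega>"] elim] show ?case by (simp add: u_def)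
  qed
  then show ?thesis by blast
qed

end

section \<open>Consequences of the Yule--Walker equation\<close>

text \<open>If \<open>r \<ge> - c\<close> everywhere, then the equation improves this to \<open>r \<ge> - c * q\<close> with
  \<open>q = l * (\<Sum>j. b (Suc j)) < 1\<close>. Iterate, starting from \<open>c = r 0\<close>.\<close>

lemma yule_walker_nonneg:
  fixes r :: "nat \<Rightarrow> real"
  assumes l: "0 \<le> l" and b: "\<And>j. 0 \<le> b (Suc j)" and sb: "summable (\<lambda>j. b (Suc j))"
    and q: "l * (\<Sum>j. b (Suc j)) < 1"
    and r: "\<And>k. \<bar>r k\<bar> \<le> r 0"
    and yw: "\<And>k. 1 \<le> k \<Longrightarrow> r k = l * (\<Sum>j. b (Suc j) * r (nat \<bar>int k - int (Suc j)\<bar>))"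
  shows "0 \<le> r k"
proof -
  define q where "q = l * (\<Sum>j. b (Suc j))"
  have q01: "0 \<le> q" "q < 1" using q l b suminf_nonneg[OF sb] by (auto simp: q_def)
  have r0: "0 \<le> r 0" using r[of 0] by linarith
  have sbr: "summable (\<lambda>j. b (Suc j) * r (nat \<bar>int k - int (Suc j)\<bar>))" for k
    using r b by (intro summable_comparison_test'[OF summable_mult2[OF sb, of "r 0"], of 0])
      (auto simp: abs_mult intro!: mult_left_mono)
  have "- (r 0 * q ^ n) \<le> r k" for n k
  proof (induction n arbitrary: k)
    case 0
    show ?case using r[of k] by simp
  next
    case (Suc n)
    show ?case
    proof (cases "k = 0")
      case True
      then show ?thesis using r0 q01 by (simp add: mult_nonneg_nonneg order_trans[of _ 0])
    next
      case False
      have "(\<Sum>j. b (Suc j) * (- (r 0 * q ^ n))) \<le> (\<Sum>j. b (Suc j) * r (nat \<bar>int k - int (Suc j)\<bar>))"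
        by (rule suminf_le[OF _ summable_mult2[OF sb] sbr]) (intro mult_left_mono Suc b)
      then have "(\<Sum>j. b (Suc j)) * (- (r 0 * q ^ n)) \<le> (\<Sum>j. b (Suc j) * r (nat \<bar>int k - int (Suc j)\<bar>))"
        by (subst suminf_mult2[OF sb])
      then have "l * ((\<Sum>j. b (Suc j)) * (- (r 0 * q ^ n)))
          \<le> l * (\<Sum>j. b (Suc j) * r (nat \<bar>int k - int (Suc j)\<bar>))"
        using l by (rule mult_left_mono)
      also have "\<dots> = r k" using False by (intro yw[symmetric]) simp
      finally have "l * ((\<Sum>j. b (Suc j)) * (- (r 0 * q ^ n))) \<le> r k" .
      then show ?thesis by (simp add: q_def mult_ac)
    qed
  qed
  moreover have "(\<lambda>n. - (r 0 * q ^ n)) \<longlonglongrightarrow> - (r 0 * 0)"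
    using q01 by (intro tendsto_intros LIMSEQ_power_zero) auto
  ultimately show ?thesis
    by (intro LIMSEQ_le_const2[of "\<lambda>n. - (r 0 * q ^ n)" 0 "r k"]) auto
qed

text \<open>The weights \<open>R ^ k\<close> are distributed over the convolution as \<open>R ^ j * R ^ (k - j)\<close>. Terms with \<open>j \<le> k\<close> are
  covered by the induction hypothesis. For \<open>j > k\<close> the argument \<open>k - j\<close> is negative, its weight is at most 1,
  and the trivial bound \<open>r 0\<close> is enough.\<close>

lemma yule_walker_decay:
  fixes r :: "nat \<Rightarrow> real"
  assumes l: "0 \<le> l" and b: "\<And>j. 0 \<le> b (Suc j)" and R: "1 \<le> R"
    and sb: "summable (\<lambda>j. b (Suc j) * R ^ Suc j)" and q: "l * (\<Sum>j. b (Suc j) * R ^ Suc j) \<le> 1"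
    and r: "\<And>k. \<bar>r k\<bar> \<le> r 0"
    and yw: "\<And>k. 1 \<le> k \<Longrightarrow> r k = l * (\<Sum>j. b (Suc j) * r (nat \<bar>int k - int (Suc j)\<bar>))"
  shows "r k \<le> r 0 * (1 / R) ^ k"
proof -
  have r0: "0 \<le> r 0" using r[of 0] by linarith
  have sb1: "summable (\<lambda>j. b (Suc j))"
  proof (rule summable_comparison_test'[OF sb, of 0])
    fix j show "norm (b (Suc j)) \<le> b (Suc j) * R ^ Suc j"
      using b[of j] one_le_power[OF R, of "Suc j"] by (simp add: mult_le_cancel_left1 del: power_Suc)
  qed
  have sbr: "summable (\<lambda>j. b (Suc j) * r (nat \<bar>int k - int (Suc j)\<bar>))" for k
    using r b by (intro summable_comparison_test'[OF summable_mult2[OF sb1, of "r 0"], of 0])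
      (auto simp: abs_mult intro!: mult_left_mono)
  have "R ^ k * r k \<le> r 0"
  proof (induction k rule: less_induct)
    case (less k)
    show ?case
    proof (cases "k = 0")
      case False
      have le: "R ^ k * r (nat \<bar>int k - int (Suc j)\<bar>) \<le> R ^ Suc j * r 0" for j
      proof (cases "Suc j \<le> k")
        case True
        then have "R ^ k = R ^ Suc j * R ^ (k - Suc j)" by (simp only: power_add[symmetric]) simp
        moreover have "R ^ (k - Suc j) * r (k - Suc j) \<le> r 0" using True by (intro less) auto
        moreover have "nat \<bar>int k - int (Suc j)\<bar> = k - Suc j" using True by linarith
        ultimately show ?thesis
          using R by (simp only: mult.assoc) (intro mult_left_mono; simp)
      next
        case False
        have "R ^ k * r (nat \<bar>int k - int (Suc j)\<bar>) \<le> R ^ k * r 0"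
          using R abs_le_D1[OF r] by (intro mult_left_mono) auto
        also have "\<dots> \<le> R ^ Suc j * r 0"
          using False R r0 by (intro mult_right_mono power_increasing) auto
        finally show ?thesis .
      qed
      have "R ^ k * (\<Sum>j. b (Suc j) * r (nat \<bar>int k - int (Suc j)\<bar>))
          = (\<Sum>j. R ^ k * (b (Suc j) * r (nat \<bar>int k - int (Suc j)\<bar>)))"
        by (rule suminf_mult[OF sbr, symmetric])
      also have "\<dots> \<le> (\<Sum>j. b (Suc j) * R ^ Suc j * r 0)"
      proof (rule suminf_le)
        fix j
        have "b (Suc j) * (R ^ k * r (nat \<bar>int k - int (Suc j)\<bar>)) \<le> b (Suc j) * (R ^ Suc j * r 0)"
          by (rule mult_left_mono[OF le b])
        then show "R ^ k * (b (Suc j) * r (nat \<bar>int k - int (Suc j)\<bar>)) \<le> b (Suc j) * R ^ Suc j * r 0"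
          by (simp only: mult.assoc mult.left_commute[of "R ^ k"])
      qed (intro summable_mult sbr summable_mult2 sb)+
      also have "\<dots> = (\<Sum>j. b (Suc j) * R ^ Suc j) * r 0" by (rule suminf_mult2[OF sb, symmetric])
      finally have "l * (R ^ k * (\<Sum>j. b (Suc j) * r (nat \<bar>int k - int (Suc j)\<bar>)))
          \<le> l * ((\<Sum>j. b (Suc j) * R ^ Suc j) * r 0)" using l by (rule mult_left_mono)
      also have "\<dots> \<le> 1 * r 0"
        unfolding mult.assoc[symmetric] by (rule mult_right_mono[OF q r0])
      finally show ?thesis
        using False by (subst yw) (auto simp: mult.left_commute)
    qed simp
  qed
  then show ?thesis using R by (simp add: power_divide field_simps)
qed

text \<open>The power series with coefficients \<open>b\<close> has radius of convergence at least \<open>1 / \<alpha> > 1\<close>, so it is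
  continuous at 1, where \<open>l\<close> times its value is below 1.\<close>

lemma geometric_bound_power_series:
  fixes b :: "nat \<Rightarrow> real"
  assumes b: "\<And>j. 0 \<le> b (Suc j)" and \<alpha>: "0 < \<alpha>" "\<alpha> < 1" and bound: "\<And>k. 1 \<le> k \<Longrightarrow> b k \<le> C * \<alpha> ^ k"
    and l: "0 \<le> l" and q: "l * (\<Sum>j. b (Suc j)) < 1"
  obtains R where "1 < R" "summable (\<lambda>j. b (Suc j) * R ^ Suc j)" "l * (\<Sum>j. b (Suc j) * R ^ Suc j) \<le> 1"
proof -
  \<comment> \<open>any number strictly between 1 and \<open>1 / \<alpha>\<close>\<close>
  define K where "K = (1 + 1 / \<alpha>) / 2"
  have K: "1 < K" "\<alpha> * K < 1" using \<alpha> by (auto simp: K_def field_simps)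
  have sK: "summable (\<lambda>j. b (Suc j) * R ^ j)" if "0 \<le> R" "R \<le> K" for R
  proof (rule summable_comparison_test'[of "\<lambda>j. C * \<alpha> * (\<alpha> * K) ^ j" 0])
    show "summable (\<lambda>j. C * \<alpha> * (\<alpha> * K) ^ j)"
      using K \<alpha> by (intro summable_mult summable_geometric) auto
    fix j
    have "b (Suc j) * R ^ j \<le> (C * \<alpha> ^ Suc j) * K ^ j"
      using bound[of "Suc j"] b[of j] that by (intro mult_mono power_mono) auto
    then show "norm (b (Suc j) * R ^ j) \<le> C * \<alpha> * (\<alpha> * K) ^ j"
      using b[of j] that by (simp add: power_mult_distrib mult_ac)
  qed
  have "isCont (\<lambda>R. \<Sum>j. b (Suc j) * R ^ j) 1"
    by (rule isCont_powser[of _ K]) (use K sK in auto)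
  then have "isCont (\<lambda>R. l * (R * (\<Sum>j. b (Suc j) * R ^ j))) 1"
    by (intro continuous_intros)
  then have "((\<lambda>R. l * (R * (\<Sum>j. b (Suc j) * R ^ j))) \<longlongrightarrow> l * (1 * (\<Sum>j. b (Suc j) * 1 ^ j))) (at_right 1)"
    unfolding isCont_def by (rule tendsto_mono[OF at_le[OF subset_UNIV]])
  then have "\<forall>\<^sub>F R in at_right 1. l * (R * (\<Sum>j. b (Suc j) * R ^ j)) < 1"
    by (rule order_tendstoD) (use q in simp)
  moreover have "\<forall>\<^sub>F R in at_right 1. R \<in> {1<..<K}"
    using K by (intro eventually_at_right_real)
  ultimately have "\<forall>\<^sub>F R in at_right 1. l * (R * (\<Sum>j. b (Suc j) * R ^ j)) < 1 \<and> R \<in> {1<..<K}"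
    by (rule eventually_conj)
  from eventually_happens[OF this] obtain R
    where R: "l * (R * (\<Sum>j. b (Suc j) * R ^ j)) < 1" "1 < R" "R < K" by auto
  have s: "summable (\<lambda>j. b (Suc j) * R ^ j)" using R by (intro sK) auto
  have "(\<lambda>j. b (Suc j) * R ^ Suc j) = (\<lambda>j. R * (b (Suc j) * R ^ j))" by (auto simp: mult_ac)
  then have "summable (\<lambda>j. b (Suc j) * R ^ Suc j)"
    "(\<Sum>j. b (Suc j) * R ^ Suc j) = R * (\<Sum>j. b (Suc j) * R ^ j)"
    using summable_mult[OF s, of R] suminf_mult[OF s, of R] by simp_all
  with R show ?thesis by (intro that) auto
qed

section \<open>Stationary solutions of the ARCH equations\<close>

locale stationary_arch = prob_space M for M :: "'w measure" +
  fixes \<xi> X :: "int \<Rightarrow> 'w \<Rightarrow> real" and a :: real and b :: "nat \<Rightarrow> real"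
  assumes iid: "iid_sequence M \<xi>"
    and mean_pos: "0 < arch_mean M \<xi>"
    and square_integrable_\<xi>0: "integrable M (\<lambda>\<omega>. (\<xi> 0 \<omega>)\<^sup>2)"
    and sd_pos: "0 < arch_sd M \<xi>"
    and a_pos: "0 < a"
    and b_nonneg: "\<And>j. 1 \<le> j \<Longrightarrow> 0 \<le> b j"
    and b_summable: "summable (\<lambda>j. b (Suc j))"
    and subcritical: "arch_mean M \<xi> * (\<Sum>j. b (Suc j)) < 1"
    and Omega_less_1: "arch_Omega M \<xi> b < 1"
    and solution: "arch_solution M \<xi> a b X"
    and stationary: "weakly_stationary M X"
begin

abbreviation l :: real where "l \<equiv> arch_mean M \<xi>"

abbreviation \<mu> :: real where "\<mu> \<equiv> expectation (X 0)"

lemma measurable_\<xi> [measurable]: "\<xi> k \<in> borel_measurable M"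
  using iid unfolding iid_sequence_def indep_vars_def by auto

lemma
  fixes f :: "real \<Rightarrow> real"
  assumes [measurable]: "f \<in> borel_measurable borel"
  shows expectation_\<xi>: "expectation (\<lambda>\<omega>. f (\<xi> k \<omega>)) = expectation (\<lambda>\<omega>. f (\<xi> 0 \<omega>))"
    and integrable_\<xi>: "integrable M (\<lambda>\<omega>. f (\<xi> k \<omega>)) \<longleftrightarrow> integrable M (\<lambda>\<omega>. f (\<xi> 0 \<omega>))"
proof -
  have d: "distr M borel (\<xi> k) = distr M borel (\<xi> 0)"
    using iid unfolding iid_sequence_def by blast
  show "expectation (\<lambda>\<omega>. f (\<xi> k \<omega>)) = expectation (\<lambda>\<omega>. f (\<xi> 0 \<omega>))"
    using integral_distr[of "\<xi> k" M borel f] integral_distr[of "\<xi> 0" M borel f] d by simp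
  show "integrable M (\<lambda>\<omega>. f (\<xi> k \<omega>)) \<longleftrightarrow> integrable M (\<lambda>\<omega>. f (\<xi> 0 \<omega>))"
    using integrable_distr_eq[of "\<xi> k" M borel f] integrable_distr_eq[of "\<xi> 0" M borel f] d by simp
qed

lemma expectation_\<xi>_eq: "expectation (\<xi> k) = l"
  using expectation_\<xi>[of "\<lambda>x. x" k] by (simp add: arch_mean_def)

lemma integrable_innovation: "integrable M (\<xi> k)"
proof (rule square_integrable_imp_integrable)
  show "integrable M (\<lambda>\<omega>. (\<xi> k \<omega>)\<^sup>2)"
    using integrable_\<xi>[of "\<lambda>x. x\<^sup>2" k] square_integrable_\<xi>0 by simp
qed simp

text \<open>Reading the innovations backwards from time \<open>k\<close> gives an i.i.d. sequence indexed by the lag.\<close>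

lemma past_iid: "iid_square_integrable M (\<lambda>m. \<xi> (k - int m)) l ((arch_sd M \<xi>)\<^sup>2)"
proof unfold_locales
  show "indep_vars (\<lambda>_. borel) (\<lambda>m. \<xi> (k - int m)) UNIV"
  proof (rule indep_vars_reindex)
    show "indep_vars (\<lambda>_. borel) \<xi> UNIV" using iid unfolding iid_sequence_def by blast
    show "inj (\<lambda>m. k - int m)" by (auto simp: inj_def)
  qed
  show "integrable M (\<lambda>\<omega>. (\<xi> (k - int n) \<omega>)\<^sup>2)" for n
    using integrable_\<xi>[of "\<lambda>x. x\<^sup>2" "k - int n"] square_integrable_\<xi>0 by simp
  show "expectation (\<xi> (k - int n)) = l" for n by (rule expectation_\<xi>_eq)
  show "expectation (\<lambda>\<omega>. (\<xi> (k - int n) \<omega> - l)\<^sup>2) = (arch_sd M \<xi>)\<^sup>2" for n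
    using expectation_\<xi>[of "\<lambda>x. (x - l)\<^sup>2" "k - int n"]
    by (simp add: arch_sd_def expectation_\<xi>_eq)
qed

lemma measurable_X [measurable]: "X k \<in> borel_measurable M"
  and square_integrable_X: "integrable M (\<lambda>\<omega>. (X k \<omega>)\<^sup>2)"
  and integrable_X: "integrable M (X k)"
  using stationary unfolding weakly_stationary_def by auto

lemma mean_X: "expectation (X k) = \<mu>"
proof -
  have "\<forall>m n. expectation (X m) = expectation (X n)"
    using stationary unfolding weakly_stationary_def by (elim conjE)
  then show ?thesis by (elim allE)
qed

lemma covariance_shift: "covariance M (X m) (X (m + j)) = covariance M (X n) (X (n + j))"
proof -
  have "\<forall>m n k. covariance M (X m) (X (m + k)) = covariance M (X n) (X (n + k))"
    using stationary unfolding weakly_stationary_def by (elim conjE)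
  then show ?thesis by (elim allE)
qed

lemma centered_square_integrable: "integrable M (\<lambda>\<omega>. (X k \<omega> - \<mu>)\<^sup>2)"
  using integrable_square_add[of "X k" M "\<lambda>_. - \<mu>"] square_integrable_X by simp

lemma variance_X: "expectation (\<lambda>\<omega>. (X k \<omega> - \<mu>)\<^sup>2) = autocovariance M X 0"
  using covariance_shift[of k 0 0]
  by (simp add: covariance_def autocovariance_def mean_X[of k] power2_eq_square)

lemma second_moment_X: "expectation (\<lambda>\<omega>. (X k \<omega>)\<^sup>2) = autocovariance M X 0 + \<mu>\<^sup>2"
  using variance_eq[OF integrable_X square_integrable_X, of k] variance_X[of k]
  by (simp add: mean_X[of k])

lemma solution_AE:
  "AE \<omega> in M. summable (\<lambda>j. b (Suc j) * X (k - int (Suc j)) \<omega>) \<and>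
     X k \<omega> = \<xi> k \<omega> * (a + (\<Sum>j. b (Suc j) * X (k - int (Suc j)) \<omega>))"
  using solution unfolding arch_solution_def arch_vol_def
  by (auto simp del: of_nat_Suc simp: mult.commute)

lemma causal:
  "\<exists>r :: nat \<Rightarrow> nat. AE \<omega> in M.
     (\<lambda>n. a * (\<Sum>m\<le>r n. \<xi> (k - int m) \<omega> * impulse b (\<lambda>m. \<xi> (k - int m) \<omega>) m)) \<longlonglongrightarrow> X k \<omega>"
proof -
  interpret past: iid_square_integrable M "\<lambda>m. \<xi> (k - int m)" l "(arch_sd M \<xi>)\<^sup>2"
    by (rule past_iid)
  have "summable (\<lambda>n. sqrt (expectation (\<lambda>\<omega>. (past.imp b n \<omega>)\<^sup>2)))"
  proof (rule past.summable_impulse_norm)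
    show "0 \<le> arch_z l b n" for n using mean_pos b_nonneg by (intro arch_z_nonneg) auto
    show "summable (arch_z l b)"
      using mean_pos b_nonneg b_summable subcritical by (intro summable_arch_z) auto
    show "sqrt ((arch_sd M \<xi>)\<^sup>2) / l * sqrt (\<Sum>j. (arch_z l b (Suc j))\<^sup>2) < 1"
      using Omega_less_1 sd_pos by (simp add: arch_Omega_def)
  qed (use mean_pos in auto)
  then have "\<exists>r :: nat \<Rightarrow> nat. AE \<omega> in M.
     (\<lambda>n. a * (\<Sum>m\<le>r n. \<xi> (k - int m) \<omega> * past.imp b m \<omega>)) \<longlonglongrightarrow> X (k - int 0) \<omega>"
  proof (rule past.causal_representation[where x = "\<lambda>m. X (k - int m)", rotated 2])
    show "AE \<omega> in M. summable (\<lambda>j. b (Suc j) * X (k - int (m + Suc j)) \<omega>) \<and>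
        X (k - int m) \<omega> = \<xi> (k - int m) \<omega> * (a + (\<Sum>j. b (Suc j) * X (k - int (m + Suc j)) \<omega>))" for m
      using solution_AE[of "k - int m"] by (simp only: of_nat_add diff_diff_add)
    show "expectation (\<lambda>\<omega>. (X (k - int m) \<omega>)\<^sup>2) = autocovariance M X 0 + \<mu>\<^sup>2" for m
      by (rule second_moment_X)
  qed (use b_nonneg b_summable square_integrable_X in auto)
  then show ?thesis by simp
qed

text \<open>The almost sure limit of functionals of \<open>(\<xi> i)\<close>, \<open>i \<le> k\<close>, is again such a functional. A version is
  defined on all paths so that independence can be derived from coordinates.\<close>

lemma causal_version:
  "\<exists>F \<in> borel_measurable (PiM UNIV (\<lambda>_. borel)).
     (\<forall>x y. (\<forall>i\<le>k. x i = y i) \<longrightarrow> F x = F y) \<and> (AE \<omega> in M. X k \<omega> = F (\<lambda>i. \<xi> i \<omega>))"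
proof -
  obtain r :: "nat \<Rightarrow> nat" where r: "AE \<omega> in M.
     (\<lambda>n. a * (\<Sum>m\<le>r n. \<xi> (k - int m) \<omega> * impulse b (\<lambda>m. \<xi> (k - int m) \<omega>) m)) \<longlonglongrightarrow> X k \<omega>"
    using causal by blast
  define F :: "(int \<Rightarrow> real) \<Rightarrow> real"
    where "F y = lim (\<lambda>n. a * (\<Sum>m\<le>r n. y (k - int m) * impulse b (\<lambda>m. y (k - int m)) m))" for y
  have "F \<in> borel_measurable (PiM UNIV (\<lambda>_. borel))"
    unfolding F_def
    by (intro borel_measurable_lim_metric borel_measurable_times borel_measurable_const
      borel_measurable_sum borel_measurable_impulse measurable_component_singleton) auto
  moreover have "F x = F y" if "\<forall>i\<le>k. x i = y i" for x y
  proof -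
    have "x (k - int m) = y (k - int m)" for m using that by auto
    then show ?thesis unfolding F_def by simp
  qed
  moreover have "AE \<omega> in M. X k \<omega> = F (\<lambda>i. \<xi> i \<omega>)"
    using r by eventually_elim (simp add: F_def limI)
  ultimately show ?thesis by blast
qed

lemma autocovariance_eq: "autocovariance M X k = expectation (\<lambda>\<omega>. (X 0 \<omega> - \<mu>) * X k \<omega>)"
proof -
  have int: "integrable M (\<lambda>\<omega>. (X 0 \<omega> - \<mu>) * X k \<omega>)"
    by (intro integrable_mult_of_squares centered_square_integrable square_integrable_X) auto
  have "autocovariance M X k = expectation (\<lambda>\<omega>. (X 0 \<omega> - \<mu>) * X k \<omega> - \<mu> * (X 0 \<omega> - \<mu>))"
    by (simp add: autocovariance_def covariance_def mean_X[of k] algebra_simps)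
  also have "\<dots> = expectation (\<lambda>\<omega>. (X 0 \<omega> - \<mu>) * X k \<omega>)"
    using int integrable_X by (simp add: prob_space)
  finally show ?thesis .
qed

lemma autocovariance_minus: "autocovariance M X (- k) = autocovariance M X k"
  using covariance_shift[of 0 "- k" k] covariance_shift[of "- k" k 0]
  by (simp add: autocovariance_def covariance_def mult.commute)

lemma autocovariance_le: "\<bar>autocovariance M X k\<bar> \<le> autocovariance M X 0"
proof -
  have "\<bar>autocovariance M X k\<bar> \<le> expectation (\<lambda>\<omega>. \<bar>(X 0 \<omega> - \<mu>) * (X k \<omega> - \<mu>)\<bar>)"
    unfolding autocovariance_def covariance_def mean_X[of "0 + k"]
    by (simp add: integral_abs_bound)
  also have "\<dots> \<le> sqrt (autocovariance M X 0) * sqrt (autocovariance M X 0)"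
    using Cauchy_Schwarz_integral[OF _ _ centered_square_integrable centered_square_integrable, of 0 k]
    by (simp add: variance_X)
  also have "0 \<le> autocovariance M X 0"
    unfolding variance_X[of 0, symmetric] by simp
  then have "sqrt (autocovariance M X 0) * sqrt (autocovariance M X 0) = autocovariance M X 0"
    by simp
  finally show ?thesis .
qed

text \<open>By causality \<open>\<xi> k\<close> is independent of \<open>(X 0 - \<mu>) * \<varsigma> k\<close>, where \<open>\<varsigma> k\<close> is the volatility at time \<open>k \<ge> 1\<close>.
  Hence the covariance of \<open>X 0\<close> and \<open>X k = \<varsigma> k * \<xi> k\<close> is \<open>l\<close> times that of \<open>X 0\<close> and \<open>\<varsigma> k\<close>, and the
  latter is expanded termwise.\<close>

lemma yule_walker:
  assumes k: "1 \<le> k"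
  shows "autocovariance M X k = l * (\<Sum>j. b (Suc j) * autocovariance M X (k - int (Suc j)))"
proof -
  obtain F where F [measurable]: "\<And>j. F j \<in> borel_measurable (PiM UNIV (\<lambda>_. borel))"
    and F_cong: "\<And>j x y. (\<And>i. i \<le> j \<Longrightarrow> x i = y i) \<Longrightarrow> F j x = F j y"
    and F_X: "\<And>j. AE \<omega> in M. X j \<omega> = F j (\<lambda>i. \<xi> i \<omega>)"
    using causal_version by metis
  \<comment> \<open>\<open>G\<close> represents \<open>(X 0 - \<mu>) * \<varsigma> k\<close> as a functional of the innovations before time \<open>k\<close>\<close>
  define G where "G y = (F 0 y - \<mu>) * (a + (\<Sum>j. b (Suc j) * F (k - int (Suc j)) y))" for y
  define Y where "Y j \<omega> = b (Suc j) * ((X 0 \<omega> - \<mu>) * X (k - int (Suc j)) \<omega>)" for j \<omega>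
  have "AE \<omega> in M. \<forall>j. X j \<omega> = F j (\<lambda>i. \<xi> i \<omega>)"
    using F_X by (subst AE_all_countable) auto
  then have G_eq: "AE \<omega> in M. G (\<lambda>i. \<xi> i \<omega>) = a * (X 0 \<omega> - \<mu>) + (\<Sum>j. Y j \<omega>)
      \<and> \<xi> k \<omega> * G (\<lambda>i. \<xi> i \<omega>) = (X 0 \<omega> - \<mu>) * X k \<omega>"
    using solution_AE[of k]
  proof eventually_elim
    case (elim \<omega>)
    then have X: "X j \<omega> = F j (\<lambda>i. \<xi> i \<omega>)"
      and s: "summable (\<lambda>j. b (Suc j) * X (k - int (Suc j)) \<omega>)"
      and e: "X k \<omega> = \<xi> k \<omega> * (a + (\<Sum>j. b (Suc j) * X (k - int (Suc j)) \<omega>))" for j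
      by blast+
    have G: "G (\<lambda>i. \<xi> i \<omega>) = (X 0 \<omega> - \<mu>) * (a + (\<Sum>j. b (Suc j) * X (k - int (Suc j)) \<omega>))"
      unfolding G_def X ..
    have "(\<Sum>j. Y j \<omega>) = (X 0 \<omega> - \<mu>) * (\<Sum>j. b (Suc j) * X (k - int (Suc j)) \<omega>)"
      unfolding Y_def by (subst suminf_mult[OF s, symmetric]) (simp only: mult.left_commute)
    with G have "G (\<lambda>i. \<xi> i \<omega>) = a * (X 0 \<omega> - \<mu>) + (\<Sum>j. Y j \<omega>)"
      by (simp only: distrib_left mult.commute)
    moreover have "\<xi> k \<omega> * G (\<lambda>i. \<xi> i \<omega>) = (X 0 \<omega> - \<mu>) * X k \<omega>"
      unfolding G e by (simp only: mult.left_commute)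
    ultimately show ?case ..
  qed
  have Gm [measurable]: "G \<in> borel_measurable (PiM UNIV (\<lambda>_. borel))"
    unfolding G_def by measurable
  have prod_int: "integrable M (\<lambda>\<omega>. (X 0 \<omega> - \<mu>) * X j \<omega>)" for j
    by (intro integrable_mult_of_squares centered_square_integrable square_integrable_X) auto
  have Yint: "integrable M (Y j)" for j
    unfolding Y_def by (intro integrable_mult_right prod_int)
  have Ynorm: "(\<integral>\<omega>. \<bar>Y j \<omega>\<bar> \<partial>M) \<le> b (Suc j) * (sqrt (autocovariance M X 0) * sqrt (autocovariance M X 0 + \<mu>\<^sup>2))" for j
  proof -
    have b: "0 \<le> b (Suc j)" using b_nonneg by simp
    have "(\<integral>\<omega>. \<bar>Y j \<omega>\<bar> \<partial>M) = b (Suc j) * (\<integral>\<omega>. \<bar>(X 0 \<omega> - \<mu>) * X (k - int (Suc j)) \<omega>\<bar> \<partial>M)"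
      unfolding Y_def using b by (simp only: abs_mult[of "b (Suc j)"] abs_of_nonneg Bochner_Integration.integral_mult_right_zero)
    also have "\<dots> \<le> b (Suc j) * (sqrt (autocovariance M X 0) * sqrt (autocovariance M X 0 + \<mu>\<^sup>2))"
      unfolding variance_X[of 0, symmetric] second_moment_X[of "k - int (Suc j)", symmetric, unfolded variance_X[of 0, symmetric]]
      by (intro mult_left_mono Cauchy_Schwarz_integral centered_square_integrable square_integrable_X b) auto
    finally show ?thesis .
  qed
  note series = dominated_series(2,3)[OF Yint Ynorm summable_mult2[OF b_summable]]
  have meas: "(\<lambda>\<omega> i. \<xi> i \<omega>) \<in> measurable M (PiM UNIV (\<lambda>_. borel))"
    by (rule measurable_PiM_single') auto
  have G\<xi>m [measurable]: "(\<lambda>\<omega>. G (\<lambda>i. \<xi> i \<omega>)) \<in> borel_measurable M"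
    using measurable_compose[OF meas Gm] .
  have lin: "integrable M (\<lambda>\<omega>. a * (X 0 \<omega> - \<mu>) + (\<Sum>j. Y j \<omega>))"
    using integrable_X series(1) by auto
  have Gint: "integrable M (\<lambda>\<omega>. G (\<lambda>i. \<xi> i \<omega>))"
    using G_eq by (subst integrable_cong_AE[OF _ _ _]) (auto intro: lin borel_measurable_integrable[OF lin])
  have ind: "indep_var borel (\<xi> k) borel (\<lambda>\<omega>. G (\<lambda>i. \<xi> i \<omega>))"
  proof (rule indep_var_function_of_others[OF _ Gm])
    show "indep_vars (\<lambda>_. borel) \<xi> UNIV" using iid unfolding iid_sequence_def by blast
    show "k \<notin> {..<k}" by simp
    fix x y :: "int \<Rightarrow> real" assume "\<And>i. i \<in> {..<k} \<Longrightarrow> x i = y i"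
    then have "F j x = F j y" if "j < k" for j using that by (intro F_cong) auto
    then have "F 0 x = F 0 y" "F (k - int (Suc j)) x = F (k - int (Suc j)) y" for j using k by auto
    then show "G x = G y" unfolding G_def by simp
  qed
  have "autocovariance M X k = expectation (\<lambda>\<omega>. \<xi> k \<omega> * G (\<lambda>i. \<xi> i \<omega>))"
    unfolding autocovariance_eq using G_eq by (intro integral_cong_AE) auto
  also have "\<dots> = l * expectation (\<lambda>\<omega>. G (\<lambda>i. \<xi> i \<omega>))"
    using indep_var_lebesgue_integral[OF ind integrable_innovation Gint] by (simp add: expectation_\<xi>_eq)
  also have "expectation (\<lambda>\<omega>. G (\<lambda>i. \<xi> i \<omega>)) = expectation (\<lambda>\<omega>. a * (X 0 \<omega> - \<mu>) + (\<Sum>j. Y j \<omega>))"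
    using G_eq by (intro integral_cong_AE) (auto intro: borel_measurable_integrable[OF lin])
  also have "\<dots> = (\<Sum>j. expectation (Y j))"
    using integrable_X series by (simp add: prob_space)
  also have "\<dots> = (\<Sum>j. b (Suc j) * autocovariance M X (k - int (Suc j)))"
    unfolding Y_def autocovariance_eq by simp
  finally show ?thesis .
qed

text \<open>A stationary solution without variance would be constant, so its volatility would be constant, too. As
  \<open>\<xi> 0\<close> is not constant, both constants would have to vanish, but a process that vanishes has volatility
  \<open>a > 0\<close>.\<close>

lemma variance_pos: "0 < autocovariance M X 0"
proof (rule ccontr)
  assume "\<not> 0 < autocovariance M X 0"
  then have var0: "expectation (\<lambda>\<omega>. (X j \<omega> - \<mu>)\<^sup>2) = 0" for j
    using autocovariance_le[of 0] by (simp add: variance_X)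
  have "AE \<omega> in M. X j \<omega> = \<mu>" for j
    using integral_nonneg_eq_0_iff_AE[OF centered_square_integrable[of j]] var0[of j] by simp
  then have "AE \<omega> in M. \<forall>j. X j \<omega> = \<mu>" by (subst AE_all_countable) auto
  then have eq: "AE \<omega> in M. \<mu> = \<xi> 0 \<omega> * (a + (\<Sum>j. b (Suc j)) * \<mu>)"
    using solution_AE[of 0]
  proof eventually_elim
    case (elim \<omega>)
    then have X: "X j \<omega> = \<mu>" for j by blast
    from elim have "X 0 \<omega> = \<xi> 0 \<omega> * (a + (\<Sum>j. b (Suc j) * X (0 - int (Suc j)) \<omega>))" by blast
    then show ?case unfolding X suminf_mult2[OF b_summable, symmetric] .
  qed
  define c where "c = a + (\<Sum>j. b (Suc j)) * \<mu>"
  have "c \<noteq> 0"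
  proof
    assume c: "c = 0"
    then have "AE \<omega> in M. \<mu> = 0" using eq by (simp add: c_def)
    then have "\<mu> = 0" by simp
    with c a_pos show False by (simp add: c_def)
  qed
  have const: "AE \<omega> in M. \<xi> 0 \<omega> = \<mu> / c"
    using eq unfolding c_def[symmetric] by eventually_elim (use \<open>c \<noteq> 0\<close> in \<open>simp add: field_simps\<close>)
  have "AE \<omega> in M. (\<xi> 0 \<omega> - l)\<^sup>2 = (\<mu> / c - l)\<^sup>2" using const by eventually_elim simp
  moreover have "l = \<mu> / c"
  proof -
    have "l = expectation (\<lambda>\<omega>. \<mu> / c)"
      unfolding arch_mean_def using const by (intro integral_cong_AE) auto
    then show ?thesis by (simp add: prob_space)
  qed
  ultimately have "expectation (\<lambda>\<omega>. (\<xi> 0 \<omega> - l)\<^sup>2) = expectation (\<lambda>\<omega>. 0)"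
    by (intro integral_cong_AE) auto
  then have "arch_sd M \<xi> = 0" by (simp add: arch_sd_def arch_mean_def)
  with sd_pos show False by simp
qed

lemma yule_walker_nat:
  assumes "1 \<le> k"
  shows "autocovariance M X (int k)
    = l * (\<Sum>j. b (Suc j) * autocovariance M X (int (nat \<bar>int k - int (Suc j)\<bar>)))"
proof -
  have "autocovariance M X (int (nat \<bar>i\<bar>)) = autocovariance M X i" for i
    using autocovariance_minus[of i] by (cases "0 \<le> i") auto
  then show ?thesis using yule_walker[of "int k"] assms by (simp del: of_nat_Suc)
qed

lemma autocovariance_nonneg: "0 \<le> autocovariance M X (int k)"
proof (rule yule_walker_nonneg[where l = l and b = b])
  show "\<bar>autocovariance M X (int k)\<bar> \<le> autocovariance M X (int 0)" for k
    using autocovariance_le by simp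
qed (use mean_pos b_nonneg b_summable subcritical yule_walker_nat in auto)

text \<open>Since all terms on the right-hand side of the Yule--Walker equation are non-negative, one may keep only
  the term in which \<open>b k\<close> multiplies \<open>\<rho> 0\<close>.\<close>

lemma coefficient_le_autocovariance:
  assumes "1 \<le> k"
  shows "l * autocovariance M X 0 * b k \<le> autocovariance M X (int k)"
proof -
  let ?f = "\<lambda>j. b (Suc j) * autocovariance M X (int (nat \<bar>int k - int (Suc j)\<bar>))"
  have f0: "0 \<le> ?f j" for j
    using b_nonneg by (intro mult_nonneg_nonneg autocovariance_nonneg) simp
  have "summable ?f"
  proof (rule summable_comparison_test'[OF summable_mult2[OF b_summable, of "autocovariance M X 0"], of 0])
    show "norm (?f j) \<le> b (Suc j) * autocovariance M X 0" for j
      using f0[of j] abs_le_D1[OF autocovariance_le] b_nonneg by (auto intro!: mult_left_mono)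
  qed
  then have "(\<Sum>j\<in>{k - 1}. ?f j) \<le> (\<Sum>j. ?f j)" using f0 by (intro sum_le_suminf) auto
  then have "b k * autocovariance M X 0 \<le> (\<Sum>j. ?f j)" using assms by simp
  then have "l * (b k * autocovariance M X 0) \<le> l * (\<Sum>j. ?f j)"
    using mean_pos by (intro mult_left_mono) auto
  also have "\<dots> = autocovariance M X (int k)" by (rule yule_walker_nat[OF assms, symmetric])
  finally show ?thesis by (simp add: mult_ac)
qed

end

section \<open>Exponential decay of coefficients and autocovariances\<close>

theorem theorem13:
  fixes M :: "'w measure"
    and \<xi> X :: "int \<Rightarrow> 'w \<Rightarrow> real"
    and a :: real
    and b :: "nat \<Rightarrow> real"
  assumes "prob_space M"
    and "iid_sequence M \<xi>"
    and "\<And>k. AE \<omega> in M. 0 \<le> \<xi> k \<omega>"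
    and "integrable M (\<xi> 0)" and "0 < arch_mean M \<xi>"
    and "integrable M (\<lambda>\<omega>. (\<xi> 0 \<omega>)\<^sup>2)" and "0 < arch_sd M \<xi>"
    and "0 < a"
    and "\<And>j. 1 \<le> j \<Longrightarrow> 0 \<le> b j"
    and "\<exists>j\<ge>1. b j \<noteq> 0"
    and "summable (\<lambda>j. b (Suc j))" and "arch_mean M \<xi> * (\<Sum>j. b (Suc j)) < 1"
    and "arch_Omega M \<xi> b < 1"
    and "arch_solution M \<xi> a b X"
    and "weakly_stationary M X"
  shows "(\<exists>\<alpha>1 C1 :: real. 0 < \<alpha>1 \<and> \<alpha>1 < 1 \<and> 0 < C1 \<and> (\<forall>k::nat. 1 \<le> k \<longrightarrow> b k \<le> C1 * \<alpha>1 ^ k))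
     \<longleftrightarrow> (\<exists>\<alpha>2 C2 :: real. 0 < \<alpha>2 \<and> \<alpha>2 < 1 \<and> 0 < C2 \<and>
            (\<forall>k::nat. autocovariance M X (int k) \<le> C2 * \<alpha>2 ^ k))"
proof
  interpret prob_space M by fact
  interpret stationary_arch M \<xi> X a b
    using assms by unfold_locales auto
  let ?\<rho> = "autocovariance M X"
  {
    assume "\<exists>\<alpha>1 C1 :: real. 0 < \<alpha>1 \<and> \<alpha>1 < 1 \<and> 0 < C1 \<and> (\<forall>k::nat. 1 \<le> k \<longrightarrow> b k \<le> C1 * \<alpha>1 ^ k)"
    then obtain \<alpha> C :: real where \<alpha>: "0 < \<alpha>" "\<alpha> < 1" and bound: "\<And>k. 1 \<le> k \<Longrightarrow> b k \<le> C * \<alpha> ^ k"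
      by blast
    have b0: "0 \<le> b (Suc j)" for j using b_nonneg by simp
    obtain R where R: "1 < R" "summable (\<lambda>j. b (Suc j) * R ^ Suc j)" "l * (\<Sum>j. b (Suc j) * R ^ Suc j) \<le> 1"
      using geometric_bound_power_series[OF b0 \<alpha> bound _ subcritical] mean_pos by (metis less_imp_le)
    have "?\<rho> (int k) \<le> ?\<rho> (int 0) * (1 / R) ^ k" for k
    proof (rule yule_walker_decay[OF _ b0 _ R(2,3) _ yule_walker_nat])
      show "\<bar>?\<rho> (int k)\<bar> \<le> ?\<rho> (int 0)" for k using autocovariance_le by simp
    qed (use mean_pos R in auto)
    then show "\<exists>\<alpha>2 C2 :: real. 0 < \<alpha>2 \<and> \<alpha>2 < 1 \<and> 0 < C2 \<and> (\<forall>k::nat. ?\<rho> (int k) \<le> C2 * \<alpha>2 ^ k)"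
      using R(1) variance_pos by (intro exI[of _ "1 / R"] exI[of _ "?\<rho> 0"]) auto
  next
    assume "\<exists>\<alpha>2 C2 :: real. 0 < \<alpha>2 \<and> \<alpha>2 < 1 \<and> 0 < C2 \<and> (\<forall>k::nat. ?\<rho> (int k) \<le> C2 * \<alpha>2 ^ k)"
    then obtain \<alpha> C :: real where \<alpha>: "0 < \<alpha>" "\<alpha> < 1" "0 < C" and bound: "\<And>k. ?\<rho> (int k) \<le> C * \<alpha> ^ k"
      by blast
    have pos: "0 < l * ?\<rho> 0" using mean_pos variance_pos by simp
    have "b k \<le> C / (l * ?\<rho> 0) * \<alpha> ^ k" if "1 \<le> k" for k
      using order_trans[OF coefficient_le_autocovariance[OF that] bound[of k]] pos
      by (simp add: pos_le_divide_eq mult.commute)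
    then show "\<exists>\<alpha>1 C1 :: real. 0 < \<alpha>1 \<and> \<alpha>1 < 1 \<and> 0 < C1 \<and> (\<forall>k::nat. 1 \<le> k \<longrightarrow> b k \<le> C1 * \<alpha>1 ^ k)"
      using \<alpha> pos by (intro exI[of _ \<alpha>] exI[of _ "C / (l * ?\<rho> 0)"]) auto
  }
qed

end
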